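(* Let $(F,\mathcal F)\subset\mathbb R^m$ be a locally closed Whitney regularly stratified set and $f:\mathbb R^n\to\mathbb R^m$ a smooth map with $f\pitchfork(F,\mathcal F)$. Let $T=(M,T^{tar},F',T^{var},f')$ be a regular transformation and let $\mathcal F'$ be a Whitney regular stratification of $F'$ as in the definition of regularity (for the given $\mathcal F$). Then: (i) $T^{var}:\mathbb R^n\to N'$ restricts to a stratified isomorphism between $f^{-1}(F,\mathcal F)$ and $f'^{-1}(F',\mathcal F')$, and $f'\circ T^{var}=T^{tar}\circ f$ on $f^{-1}(F)$, with $f$, $f'$, $T^{var}$, $T^{tar}$ mapping strata into strata; (ii) if $z\in Z\in\mathcal F$ and $z'=T^{tar}(z)\in Z'\in\mathcal F'$, then $T^{tar}$ is a stratified isomorphism between suitable representatives of the fibers $(F,\mathcal F)_{Z,z}$ and $(F',\mathcal F')_{Z',z'}$.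
   Context: Transformation: given $F\subset\mathbb R^m$ (admitting a Whitney regular stratification) and smooth $f:\mathbb R^n\to\mathbb R^m$, a transformation consists of a smooth submanifold $M\subset\mathbb R^{m'}$, a smooth embedding $T^{tar}:\mathbb R^m\to M$, a set $F'\subset\mathbb R^{m'}$, a smooth embedding $T^{var}:\mathbb R^n\to\mathbb R^{n'}$ and a smooth map $f':\mathbb R^{n'}\to\mathbb R^{m'}$ such that, with $M':=T^{tar}(\mathbb R^m)$ and $N':=T^{var}(\mathbb R^n)$: $T^{tar}(F)=F'\cap M$; $f'\circ T^{var}=T^{tar}\circ f$; $f'(\mathbb R^{n'})\subset M$; $f'^{-1}(M')\subset N'$. It is regular if for every Whitney regular stratification $\mathcal F$ of $F$ there is a Whitney regular stratification $\mathcal F'$ of $F'$ such that $\{T^{tar}(Z):Z\in\mathcal F\}$ coincides with $\{Z'\cap M:Z'\in\mathcal F',\ Z'\cap M\ne\emptyset\}$, the inclusion $M\hookrightarrow\mathbb R^{m'}$ is transversal to every stratum of $\mathcal F'$, and $f':\mathbb R^{n'}\to M$ is transversal to $M'$ in $M$. Stratification: locally finite partition into smooth submanifolds (strata); Whitney regular: for distinct strata $X,Y$, $\bar x\in X\cap\overline Y$, $x_k\in X$, $y_k\in Y\to\bar x$ with $\mathrm{span}(y_k-x_k)\to L$, $T_{y_k}Y\to T$ imply $L\subset T$. A map $\phi$ is transversal to a stratum $X$ if $D\phi(y)[\text{domain tangent}]+T_{\phi(y)}X$ equals the ambient tangent space for all $y\in\phi^{-1}(X)$; $f\pitchfork(F,\mathcal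 F)$ means transversality to all strata. $f^{-1}(F,\mathcal F):=(f^{-1}(F),\{f^{-1}(Z):Z\in\mathcal F\})$. A stratified isomorphism is a homeomorphism mapping each stratum diffeomorphically onto a stratum. The fiber $(F,\mathcal F)_{Z,z}$ is $(F\cap\pi^{-1}(z),\{Y\cap\pi^{-1}(z)\})$ near $z$ for a tube $(T,\pi,\rho)$ at $Z$ (open $T\supset Z$, smooth retraction $\pi:T\to Z$, $\rho$ quadratic distance function of a Riemannian metric). *)

theory Defs
  imports "HOL-Analysis.Analysis"
begin

definition smooth_on :: "'a::euclidean_space set \<Rightarrow> ('a \<Rightarrow> 'b::euclidean_space) \<Rightarrow> bool" where
  "smooth_on S f \<longleftrightarrow> open S \<and>
     (\<exists>D. f \<in> D \<and> (\<forall>g\<in>D. (\<forall>x\<in>S. g differentiable (at x)) \<and>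
                          (\<forall>v. (\<lambda>x. frechet_derivative g (at x) v) \<in> D)))"

definition smooth :: "('a::euclidean_space \<Rightarrow> 'b::euclidean_space) \<Rightarrow> bool" where
  "smooth f \<longleftrightarrow> smooth_on UNIV f"

definition smooth_map_on :: "'a::euclidean_space set \<Rightarrow> ('a \<Rightarrow> 'b::euclidean_space) \<Rightarrow> bool" where
  "smooth_map_on S g \<longleftrightarrow>
     (\<forall>x\<in>S. \<exists>U h. x \<in> U \<and> smooth_on U h \<and> (\<forall>y\<in>S \<inter> U. h y = g y))"

definition diffeo_betw :: "('a::euclidean_space \<Rightarrow> 'b::euclidean_space) \<Rightarrow> 'a set \<Rightarrow> 'b set \<Rightarrow> bool" where
  "diffeo_betw h X Y \<longleftrightarrow> bij_betw h X Y \<and> smooth_map_on X h \<and> smooth_map_on Y (inv_into X h)"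

definition submanifold :: "'a::euclidean_space set \<Rightarrow> bool" where
  "submanifold M \<longleftrightarrow>
     (\<forall>p\<in>M. \<exists>U V (\<phi>::'a \<Rightarrow> 'a) \<psi> L. open U \<and> p \<in> U \<and> open V \<and> smooth_on U \<phi> \<and> smooth_on V \<psi> \<and>
        \<phi> ` U = V \<and> (\<forall>x\<in>U. \<psi> (\<phi> x) = x) \<and> (\<forall>y\<in>V. \<phi> (\<psi> y) = y) \<and>
        subspace L \<and> \<phi> ` (M \<inter> U) = V \<inter> L)"

definition tangent_space :: "'a::euclidean_space set \<Rightarrow> 'a \<Rightarrow> 'a set" where
  "tangent_space M x = {v. \<exists>\<gamma>::real \<Rightarrow> 'a. \<gamma> 0 = x \<and> (\<forall>t. \<gamma> t \<in> M) \<and> (\<gamma> has_vector_derivative v) (at 0)}"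

definition set_sum :: "'a::ab_group_add set \<Rightarrow> 'a set \<Rightarrow> 'a set" where
  "set_sum A B = {a + b | a b. a \<in> A \<and> b \<in> B}"

definition transversal :: "('a::euclidean_space \<Rightarrow> 'b::euclidean_space) \<Rightarrow> 'b set \<Rightarrow> bool" where
  "transversal \<phi> X \<longleftrightarrow>
     (\<forall>y. \<phi> y \<in> X \<longrightarrow> set_sum (range (frechet_derivative \<phi> (at y))) (tangent_space X (\<phi> y)) = UNIV)"

definition transversal_in :: "('a::euclidean_space \<Rightarrow> 'b::euclidean_space) \<Rightarrow> 'b set \<Rightarrow> 'b set \<Rightarrow> bool" where
  "transversal_in \<phi> M M' \<longleftrightarrow>
     (\<forall>y. \<phi> y \<in> M' \<longrightarrow>
        set_sum (range (frechet_derivative \<phi> (at y))) (tangent_space M' (\<phi> y)) = tangent_space M (\<phi> y))"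

definition inclusion_transversal :: "'a::euclidean_space set \<Rightarrow> 'a set \<Rightarrow> bool" where
  "inclusion_transversal M X \<longleftrightarrow>
     (\<forall>p\<in>M \<inter> X. set_sum (tangent_space M p) (tangent_space X p) = UNIV)"

text \<open>Convergence of linear subspaces (in the Grassmannian).\<close>
definition subspace_lim :: "(nat \<Rightarrow> 'a::euclidean_space set) \<Rightarrow> 'a set \<Rightarrow> bool" where
  "subspace_lim A S \<longleftrightarrow> subspace S \<and> (\<forall>k. subspace (A k)) \<and>
     eventually (\<lambda>k. dim (A k) = dim S) sequentially \<and>
     (\<forall>v\<in>S. \<exists>a. (\<forall>k. a k \<in> A k) \<and> a \<longlonglongrightarrow> v)"

definition locally_closed :: "'a::topological_space set \<Rightarrow> bool" where
  "locally_closed F \<longleftrightarrow> (\<exists>U C. open U \<and> closed C \<and> F = U \<inter> C)"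

definition whitney_strat :: "'a::euclidean_space set \<Rightarrow> 'a set set \<Rightarrow> bool" where
  "whitney_strat F FF \<longleftrightarrow>
     \<Union>FF = F \<and> (\<forall>X\<in>FF. X \<noteq> {}) \<and> disjoint FF \<and> (\<forall>X\<in>FF. submanifold X) \<and>
     (\<forall>x\<in>F. \<exists>U. open U \<and> x \<in> U \<and> finite {X\<in>FF. X \<inter> U \<noteq> {}}) \<and>
     (\<forall>X\<in>FF. \<forall>Y\<in>FF. X \<noteq> Y \<longrightarrow> (\<forall>xb \<in> X \<inter> closure Y. \<forall>xs ys L T.
        (\<forall>k. xs k \<in> X) \<and> (\<forall>k. ys k \<in> Y) \<and> xs \<longlonglongrightarrow> xb \<and> ys \<longlonglongrightarrow> xb \<and>
        subspace_lim (\<lambda>k. span {ys k - xs k}) L \<and>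
        subspace_lim (\<lambda>k. tangent_space Y (ys k)) T \<longrightarrow> L \<subseteq> T))"

definition preimage_strata :: "('a \<Rightarrow> 'b) \<Rightarrow> 'b set set \<Rightarrow> 'a set set" where
  "preimage_strata f FF = {f -` Z | Z. Z \<in> FF} - {{}}"

definition strat_iso ::
  "('a::euclidean_space \<Rightarrow> 'b::euclidean_space) \<Rightarrow> 'a set \<Rightarrow> 'a set set \<Rightarrow> 'b set \<Rightarrow> 'b set set \<Rightarrow> bool" where
  "strat_iso h A AA B BB \<longleftrightarrow> (\<exists>g. homeomorphism A B h g) \<and>
     (\<forall>X\<in>AA. \<exists>Y\<in>BB. h ` X = Y \<and> diffeo_betw h X Y)"

definition smooth_embedding :: "('a::euclidean_space \<Rightarrow> 'b::euclidean_space) \<Rightarrow> bool" where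
  "smooth_embedding T \<longleftrightarrow> smooth T \<and> inj T \<and> (\<forall>x. inj (frechet_derivative T (at x))) \<and>
     continuous_on (range T) (inv T)"

definition transformation ::
  "'b::euclidean_space set \<Rightarrow> ('a::euclidean_space \<Rightarrow> 'b) \<Rightarrow> 'c::euclidean_space set \<Rightarrow> ('b \<Rightarrow> 'c) \<Rightarrow>
   'c set \<Rightarrow> ('a \<Rightarrow> 'd::euclidean_space) \<Rightarrow> ('d \<Rightarrow> 'c) \<Rightarrow> bool" where
  "transformation F f M Ttar F' Tvar f' \<longleftrightarrow>
     (\<exists>FF. whitney_strat F FF) \<and> smooth f \<and>
     submanifold M \<and> smooth_embedding Ttar \<and> range Ttar \<subseteq> M \<and>
     smooth_embedding Tvar \<and> smooth f' \<and>
     Ttar ` F = F' \<inter> M \<and> f' \<circ> Tvar = Ttar \<circ> f \<and> range f' \<subseteq> M \<and>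
     f' -` (range Ttar) \<subseteq> range Tvar"

definition regular_for ::
  "'b::euclidean_space set set \<Rightarrow> 'c::euclidean_space set \<Rightarrow> ('b \<Rightarrow> 'c) \<Rightarrow>
   'c set \<Rightarrow> ('d::euclidean_space \<Rightarrow> 'c) \<Rightarrow> 'c set set \<Rightarrow> bool" where
  "regular_for FF M Ttar F' f' FF' \<longleftrightarrow>
     whitney_strat F' FF' \<and>
     (\<lambda>Z. Ttar ` Z) ` FF = {Z' \<inter> M | Z'. Z' \<in> FF' \<and> Z' \<inter> M \<noteq> {}} \<and>
     (\<forall>Z'\<in>FF'. inclusion_transversal M Z') \<and>
     transversal_in f' M (range Ttar)"

definition regular_transformation ::
  "'b::euclidean_space set \<Rightarrow> ('a::euclidean_space \<Rightarrow> 'b) \<Rightarrow> 'c::euclidean_space set \<Rightarrow> ('b \<Rightarrow> 'c) \<Rightarrow>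
   'c set \<Rightarrow> ('a \<Rightarrow> 'd::euclidean_space) \<Rightarrow> ('d \<Rightarrow> 'c) \<Rightarrow> bool" where
  "regular_transformation F f M Ttar F' Tvar f' \<longleftrightarrow>
     transformation F f M Ttar F' Tvar f' \<and>
     (\<forall>FF. whitney_strat F FF \<longrightarrow> (\<exists>FF'. regular_for FF M Ttar F' f' FF'))"

definition riemannian_metric :: "'a::euclidean_space set \<Rightarrow> ('a \<Rightarrow> 'a \<Rightarrow> 'a \<Rightarrow> real) \<Rightarrow> bool" where
  "riemannian_metric U g \<longleftrightarrow>
     (\<forall>p\<in>U. bilinear (g p) \<and> (\<forall>u v. g p u v = g p v u) \<and> (\<forall>u. u \<noteq> 0 \<longrightarrow> g p u u > 0)) \<and>
     (\<forall>u v. smooth_on U (\<lambda>p. g p u v))"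

definition tube :: "'a::euclidean_space set \<Rightarrow> 'a set \<Rightarrow> ('a \<Rightarrow> 'a) \<Rightarrow> ('a \<Rightarrow> real) \<Rightarrow> bool" where
  "tube Z T \<pi> \<rho> \<longleftrightarrow> open T \<and> Z \<subseteq> T \<and> smooth_on T \<pi> \<and> \<pi> ` T \<subseteq> Z \<and> (\<forall>z\<in>Z. \<pi> z = z) \<and>
     (\<exists>g. riemannian_metric T g \<and> (\<forall>x\<in>T. \<rho> x = g (\<pi> x) (x - \<pi> x) (x - \<pi> x)))"

text \<open>Representative of the fiber (F,FF)_{Z,z} in the tube with retraction pi, cut down to U.\<close>
definition fiber_set :: "'a set \<Rightarrow> ('a \<Rightarrow> 'a) \<Rightarrow> 'a \<Rightarrow> 'a set \<Rightarrow> 'a set" where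
  "fiber_set F \<pi> z U = F \<inter> \<pi> -` {z} \<inter> U"

definition fiber_strata :: "'a set set \<Rightarrow> ('a \<Rightarrow> 'a) \<Rightarrow> 'a \<Rightarrow> 'a set \<Rightarrow> 'a set set" where
  "fiber_strata FF \<pi> z U = {Y \<inter> \<pi> -` {z} \<inter> U | Y. Y \<in> FF} - {{}}"

end

theory Submission
  imports Defs
begin

text \<open>
  The first part holds because \<open>f'\<close> takes values in \<open>M\<close> and \<open>f' -` range Ttar \<subseteq> range Tvar\<close>, so that
  \<open>f' -` Z'\<close> is the image under the embedding \<open>Tvar\<close> of \<open>f -` Z\<close> whenever \<open>Ttar ` Z = Z' \<inter> M\<close>.

  For the fibers, transversality of \<open>M\<close> and \<open>Z'\<close> at \<open>z' = Ttar z\<close> allows straightening both to linear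
  subspaces near \<open>z'\<close>. A linear projection onto the second whose kernel lies in the first gives a local
  retraction onto \<open>Z'\<close> which preserves \<open>M\<close> and whose fiber over \<open>z'\<close> lies in \<open>M\<close>. It pulls back
  along \<open>Ttar\<close> to a local retraction onto \<open>Z\<close> with the corresponding fiber over \<open>z\<close>. Both extend to
  tubes: the nearest point projection gives a global smooth retraction, and a bump function
  interpolates between it and the local one.
\<close>

text \<open>\<open>Tvar\<close> and \<open>Ttar\<close> embed whole Euclidean spaces, so restricted
  to any set they are homeomorphisms and \<open>diffeo_betw\<close> onto the image; each stratified
  isomorphism thus reduces to identities between sets. For fibers these depend on the tubes: nothing
  ties the retraction of an arbitrary tube at \<open>Z'\<close> to \<open>M\<close>, so the two
  tubes must be built to match. The required projection exists because the tangent spaces of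
  \<open>M\<close> and \<open>Z'\<close> at \<open>z'\<close> span everything: a complement of the
  second can be chosen inside the first. This construction is local around \<open>z'\<close>, while
  a tube needs a retraction near the whole stratum; hence the extension. Strata need not be closed,
  so nearest points are controlled only near the stratum, at a scale that varies with the point. All
  of this needs smooth local inverses, and \<open>smooth_on\<close> is defined through a class
  closed under derivatives, so the calculus up to the inverse function theorem is developed order by
  order.\<close>

section \<open>Finite order smoothness\<close>

text \<open>A bounded order allows induction, which the derivative-closed class \<open>D\<close> of
  \<open>smooth_on\<close> does not offer directly. Derivatives in a fixed direction
  \<open>v\<close> stay in the same function type. Order 0 asks for nothing, not even
  continuity.\<close>

primrec k_smooth_on :: "nat \<Rightarrow> 'a::euclidean_space set \<Rightarrow> ('a \<Rightarrow> 'b::euclidean_space) \<Rightarrow> bool" where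
  "k_smooth_on 0 S f \<longleftrightarrow> True"
| "k_smooth_on (Suc k) S f \<longleftrightarrow> (\<forall>x\<in>S. f differentiable (at x)) \<and>
     (\<forall>v. k_smooth_on k S (\<lambda>x. frechet_derivative f (at x) v))"

lemma smooth_on_iff_k_smooth_on: "smooth_on S f \<longleftrightarrow> open S \<and> (\<forall>k. k_smooth_on k S f)"
proof
  assume "smooth_on S f"
  then obtain D where "open S" "f \<in> D"
    and D: "\<And>g. g \<in> D \<Longrightarrow> (\<forall>x\<in>S. g differentiable (at x)) \<and> (\<forall>v. (\<lambda>x. frechet_derivative g (at x) v) \<in> D)"
    by (auto simp: smooth_on_def)
  have "g \<in> D \<Longrightarrow> k_smooth_on k S g" for k g
    by (induction k arbitrary: g) (use D in auto)
  then show "open S \<and> (\<forall>k. k_smooth_on k S f)"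
    using \<open>open S\<close> \<open>f \<in> D\<close> by blast
next
  assume R: "open S \<and> (\<forall>k. k_smooth_on k S f)"
  show "smooth_on S f"
    unfolding smooth_on_def
  \<comment> \<open>The witness is the largest class that can work.\<close>
  proof (intro conjI exI[of _ "{g. \<forall>k. k_smooth_on k S g}"] ballI allI)
    fix g :: "'a \<Rightarrow> 'b" and x v
    assume "g \<in> {g. \<forall>k. k_smooth_on k S g}"
    then have "k_smooth_on (Suc k) S g" for k by blast
    then show "x \<in> S \<Longrightarrow> g differentiable (at x)"
      and "(\<lambda>x. frechet_derivative g (at x) v) \<in> {g. \<forall>k. k_smooth_on k S g}" by auto
  qed (use R in auto)
qed

lemma k_smooth_on_cong:
  assumes "open S" "\<And>x. x \<in> S \<Longrightarrow> f x = g x" "k_smooth_on k S f"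
  shows "k_smooth_on k S g"
  using assms(2,3)
proof (induction k arbitrary: f g)
  case (Suc k)
  have "g differentiable (at x)" if "x \<in> S" for x
    using Suc.prems that assms(1)
    by (meson differentiable_def has_derivative_transform_within_open k_smooth_on.simps(2))
  moreover have "frechet_derivative f (at x) = frechet_derivative g (at x)" if "x \<in> S" for x
    using Suc.prems that assms(1) frechet_derivative_transform_within_open[of f x S g] by auto
  ultimately show ?case
    using Suc.prems(2) Suc.IH[of "\<lambda>x. frechet_derivative f (at x) _" "\<lambda>x. frechet_derivative g (at x) _"]
    by auto
qed auto

lemma k_smooth_on_SucI:
  assumes "open S" "\<And>x. x \<in> S \<Longrightarrow> (f has_derivative f' x) (at x)"
    and "\<And>v. k_smooth_on k S (\<lambda>x. f' x v)"
  shows "k_smooth_on (Suc k) S f"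
proof -
  have "f' x = frechet_derivative f (at x)" if "x \<in> S" for x
    using assms(2)[OF that] frechet_derivative_at by blast
  then have "k_smooth_on k S (\<lambda>x. frechet_derivative f (at x) v)" for v
    by (intro k_smooth_on_cong[OF assms(1) _ assms(3)[of v]]) simp
  then show ?thesis
    using assms(2) by (auto simp: differentiable_def)
qed

lemma k_smooth_on_SucD:
  assumes "k_smooth_on (Suc k) S f"
  shows "x \<in> S \<Longrightarrow> (f has_derivative frechet_derivative f (at x)) (at x)"
    and "k_smooth_on k S (\<lambda>x. frechet_derivative f (at x) v)"
  using assms frechet_derivative_works by auto

lemma k_smooth_on_mono: "k_smooth_on (Suc k) S f \<Longrightarrow> k_smooth_on k S f"
proof (induction k arbitrary: f)
  case (Suc k)
  show ?case
    using Suc.prems Suc.IH[OF k_smooth_on_SucD(2)[OF Suc.prems]] by simp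
qed auto

lemma k_smooth_on_subset: "k_smooth_on k S f \<Longrightarrow> T \<subseteq> S \<Longrightarrow> k_smooth_on k T f"
proof (induction k arbitrary: f)
  case (Suc k)
  then show ?case by (metis k_smooth_on.simps(2) subsetD)
qed auto

lemma k_smooth_on_const: "open S \<Longrightarrow> k_smooth_on k S (\<lambda>x. c)"
proof (induction k arbitrary: c)
  case (Suc k)
  then show ?case by (intro k_smooth_on_SucI[where f'="\<lambda>x v. 0"]) auto
qed auto

lemma k_smooth_on_linear:
  assumes "open S" "bounded_linear f"
  shows "k_smooth_on k S f"
proof (cases k)
  case (Suc j)
  then show ?thesis
    using assms k_smooth_on_SucI[of S f "\<lambda>x. f"] k_smooth_on_const bounded_linear_imp_has_derivative
    by blast
qed auto

lemma k_smooth_on_add: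
  "open S \<Longrightarrow> k_smooth_on k S f \<Longrightarrow> k_smooth_on k S g \<Longrightarrow> k_smooth_on k S (\<lambda>x. f x + g x)"
proof (induction k arbitrary: f g)
  case (Suc k)
  note D = k_smooth_on_SucD[OF Suc.prems(2)] k_smooth_on_SucD[OF Suc.prems(3)]
  show ?case
    by (rule k_smooth_on_SucI[OF Suc.prems(1)])
      (auto intro!: has_derivative_add D Suc.IH[OF Suc.prems(1)])
qed auto

lemma k_smooth_on_sum:
  assumes "open S" "\<And>i. i \<in> I \<Longrightarrow> k_smooth_on k S (f i)"
  shows "k_smooth_on k S (\<lambda>x. \<Sum>i\<in>I. f i x)"
  using assms(2)
  by (induction I rule: infinite_finite_induct) (auto intro: k_smooth_on_const k_smooth_on_add assms(1))

lemma k_smooth_on_bilinear: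
  assumes "bounded_bilinear B" "open S"
  shows "k_smooth_on k S f \<Longrightarrow> k_smooth_on k S g \<Longrightarrow> k_smooth_on k S (\<lambda>x. B (f x) (g x))"
proof (induction k arbitrary: f g)
  case (Suc k)
  note D = k_smooth_on_SucD[OF Suc.prems(1)] k_smooth_on_SucD[OF Suc.prems(2)]
  show ?case
  proof (rule k_smooth_on_SucI[OF assms(2)])
    fix x assume "x \<in> S"
    then show "((\<lambda>x. B (f x) (g x)) has_derivative
        (\<lambda>v. B (f x) (frechet_derivative g (at x) v) + B (frechet_derivative f (at x) v) (g x))) (at x)"
      using bounded_bilinear.FDERIV[OF assms(1)] D by blast
  next
    fix v
    show "k_smooth_on k S (\<lambda>x. B (f x) (frechet_derivative g (at x) v)
          + B (frechet_derivative f (at x) v) (g x))"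
      using Suc.prems D by (intro k_smooth_on_add assms Suc.IH) (auto intro: k_smooth_on_mono)
  qed
qed auto

text \<open>Serves mainly to replace a derivative in a direction depending on the point by a finite
  sum of coefficients times derivatives in fixed directions, the only ones
  \<open>k_smooth_on\<close> speaks of.\<close>

lemma linear_Basis_expansion:
  fixes f :: "'a::euclidean_space \<Rightarrow> 'b::real_vector"
  assumes "linear f"
  shows "f v = (\<Sum>b\<in>Basis. (v \<bullet> b) *\<^sub>R f b)"
proof -
  have "f v = f (\<Sum>b\<in>Basis. (v \<bullet> b) *\<^sub>R b)"
    by (simp add: euclidean_representation)
  also have "\<dots> = (\<Sum>b\<in>Basis. (v \<bullet> b) *\<^sub>R f b)"
    using assms by (simp add: linear_sum linear_scale)
  finally show ?thesis .
qed

text \<open>The chain rule evaluates the derivative of \<open>f\<close> in the varying direction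
  \<open>frechet_derivative g (at x) v\<close>; after expansion in \<open>Basis\<close> the
  induction hypothesis applies to each fixed direction \<open>b\<close>.\<close>

lemma k_smooth_on_compose:
  assumes "open S" "open T" "\<And>x. x \<in> S \<Longrightarrow> g x \<in> T"
  shows "k_smooth_on k T f \<Longrightarrow> k_smooth_on k S g \<Longrightarrow> k_smooth_on k S (\<lambda>x. f (g x))"
proof (induction k arbitrary: f)
  case (Suc k)
  note D = k_smooth_on_SucD[OF Suc.prems(1)] k_smooth_on_SucD[OF Suc.prems(2)]
  show ?case
  proof (rule k_smooth_on_SucI[OF assms(1)])
    fix x assume x: "x \<in> S"
    have "(f has_derivative frechet_derivative f (at (g x))) (at (g x))"
      using x assms(3) D(1) by blast
    from has_derivative_compose[OF D(3)[OF x] this]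
    show "((\<lambda>x. f (g x)) has_derivative
        (\<lambda>v. \<Sum>b\<in>Basis. (frechet_derivative g (at x) v \<bullet> b) *\<^sub>R frechet_derivative f (at (g x)) b)) (at x)"
      by (subst (asm) linear_Basis_expansion[OF has_derivative_linear[OF D(1)[OF assms(3)[OF x]]]])
  next
    fix v
    show "k_smooth_on k S (\<lambda>x. \<Sum>b\<in>Basis.
        (frechet_derivative g (at x) v \<bullet> b) *\<^sub>R frechet_derivative f (at (g x)) b)"
      using Suc.prems D
      by (intro k_smooth_on_sum k_smooth_on_bilinear[OF bounded_bilinear_scaleR]
          k_smooth_on_bilinear[OF bounded_bilinear_inner] k_smooth_on_const assms(1) Suc.IH)
        (auto intro: k_smooth_on_mono)
  qed
qed auto

section \<open>Smooth dependence of inverse linear maps on parameters\<close>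

lemma derivative_linear_family:
  fixes A :: "'a::euclidean_space \<Rightarrow> 'b::euclidean_space \<Rightarrow> 'c::real_normed_vector"
  assumes S: "open S" "x \<in> S" and lin: "\<And>x. x \<in> S \<Longrightarrow> linear (A x)"
    and dA: "\<And>w. ((\<lambda>x. A x w) has_derivative A' w) (at x)"
  shows "A' w d = (\<Sum>b\<in>Basis. (w \<bullet> b) *\<^sub>R A' b d)"
proof -
  have "((\<lambda>y. \<Sum>b\<in>Basis. (w \<bullet> b) *\<^sub>R A y b) has_derivative (\<lambda>d. \<Sum>b\<in>Basis. (w \<bullet> b) *\<^sub>R A' b d)) (at x)"
    by (auto intro!: derivative_eq_intros dA)
  then have "((\<lambda>y. A y w) has_derivative (\<lambda>d. \<Sum>b\<in>Basis. (w \<bullet> b) *\<^sub>R A' b d)) (at x)"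
    by (rule has_derivative_transform_within_open[OF _ S]) (metis lin linear_Basis_expansion)
  from has_derivative_unique[OF dA this] show ?thesis by (rule fun_cong)
qed

text \<open>The map \<open>\<Phi>\<close> of pairs has inverse \<open>G\<close>, and its derivative
  at \<open>(x, w)\<close> is block triangular with invertible diagonal.
  \<open>has_derivative_inverse_strong\<close> differentiates \<open>G\<close> without a prior proof
  that the inverse is continuous; restricting to the slice of pairs \<open>(y, v)\<close> gives the
  formula.\<close>

lemma has_derivative_linear_family_inverse:
  fixes A :: "'a::euclidean_space \<Rightarrow> 'b::euclidean_space \<Rightarrow> 'b"
  assumes S: "open S" "x \<in> S" and lin: "\<And>x. x \<in> S \<Longrightarrow> linear (A x)" and bij: "\<And>x. x \<in> S \<Longrightarrow> bij (A x)"
    and dA: "\<And>x w. x \<in> S \<Longrightarrow> ((\<lambda>x. A x w) has_derivative A' x w) (at x)"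
  shows "((\<lambda>x. inv (A x) v) has_derivative (\<lambda>d. - inv (A x) (A' x (inv (A x) v) d))) (at x)"
proof -
  define \<Phi> where "\<Phi> = (\<lambda>(y, w). (y, A y w))"
  define G where "G = (\<lambda>(y, w). (y, inv (A y) w))"
  have der: "(\<Phi> has_derivative (\<lambda>(d, e). (d, (\<Sum>b\<in>Basis. (snd p \<bullet> b) *\<^sub>R A' (fst p) b d + (e \<bullet> b) *\<^sub>R A (fst p) b)))) (at p)"
    if p: "p \<in> S \<times> UNIV" for p
  proof -
    have 1: "((\<lambda>q. A (fst q) b) has_derivative (\<lambda>h. A' (fst p) b (fst h))) (at p)" for b
      by (rule has_derivative_compose[of fst fst p UNIV "\<lambda>y. A y b"])
        (use p dA in \<open>auto intro!: derivative_eq_intros\<close>)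
    have "((\<lambda>q. (fst q, \<Sum>b\<in>Basis. (snd q \<bullet> b) *\<^sub>R A (fst q) b)) has_derivative
       (\<lambda>(d, e). (d, (\<Sum>b\<in>Basis. (snd p \<bullet> b) *\<^sub>R A' (fst p) b d + (e \<bullet> b) *\<^sub>R A (fst p) b)))) (at p)"
      by (auto intro!: derivative_eq_intros 1 simp: case_prod_unfold)
    moreover have "open (S \<times> (UNIV :: 'b set))" using S by (simp add: open_Times)
    ultimately show ?thesis
    proof (rule has_derivative_transform_within_open[OF _ _ p])
      fix q :: "'a \<times> 'b" assume "q \<in> S \<times> UNIV"
      then show "(fst q, \<Sum>b\<in>Basis. (snd q \<bullet> b) *\<^sub>R A (fst q) b) = \<Phi> q"
        using linear_Basis_expansion[OF lin] by (auto simp: \<Phi>_def case_prod_unfold)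
    qed
  qed
  have linA': "(\<Sum>b\<in>Basis. (w \<bullet> b) *\<^sub>R A' x b d) = A' x w d" for w d
    by (rule derivative_linear_family[where A=A and A'="A' x", OF S lin dA[OF S(2)], symmetric])
  define w where "w = inv (A x) v"
  have Aw: "A x w = v" using bij[OF S(2)] by (simp add: w_def bij_is_surj surj_f_inv_f)
  have derx: "(\<Phi> has_derivative (\<lambda>(d, e). (d, A' x w d + A x e))) (at (x, w))"
    using der[of "(x, w)"] S by (simp add: sum.distrib linA' linear_Basis_expansion[OF lin[OF S(2)], symmetric])
  have "(G has_derivative (\<lambda>(d, e). (d, inv (A x) (e - A' x w d)))) (at (\<Phi> (x, w)))"
  proof (rule has_derivative_inverse_strong[of "S \<times> (UNIV :: 'b set)" _ \<Phi> G, OF _ _ _ _ derx])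
    show "continuous_on (S \<times> UNIV) \<Phi>"
      by (intro continuous_at_imp_continuous_on ballI) (rule has_derivative_continuous[OF der])
    show "G (\<Phi> p) = p" if "p \<in> S \<times> UNIV" for p
      using that bij by (auto simp: G_def \<Phi>_def bij_is_inj)
    show "(\<lambda>(d, e). (d, A' x w d + A x e)) \<circ> (\<lambda>(d, e). (d, inv (A x) (e - A' x w d))) = id"
      using bij[OF S(2)] by (auto simp: fun_eq_iff bij_is_surj surj_f_inv_f)
      show "open (S \<times> (UNIV :: 'b set))" "(x, w) \<in> S \<times> UNIV" using S by (auto simp: open_Times)
  qed
  then have G: "(G has_derivative (\<lambda>(d, e). (d, inv (A x) (e - A' x w d)))) (at (x, v))"
    by (simp add: \<Phi>_def Aw)
  have "((\<lambda>y. (y, v)) has_derivative (\<lambda>d. (d, 0))) (at x)"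
    by (auto intro!: derivative_eq_intros)
  from has_derivative_snd[OF has_derivative_compose[OF this G]]
  have "((\<lambda>y. inv (A y) v) has_derivative (\<lambda>d. inv (A x) (0 - A' x w d))) (at x)"
    by (simp add: G_def)
  moreover have "linear (inv (A x))"
    using bij[OF S(2)] lin[OF S(2)] inj_linear_imp_inv_linear bij_is_inj by blast
  ultimately show ?thesis
    by (simp add: w_def linear_neg)
qed

text \<open>Bootstrapping: the derivative of the inverse involves only the inverse itself and one
  derivative of \<open>A\<close>, so order \<open>k\<close> of the inverse and order
  \<open>Suc k\<close> of \<open>A\<close> give order \<open>Suc k\<close> of the inverse.\<close>

lemma k_smooth_on_linear_family_inverse:
  fixes A :: "'a::euclidean_space \<Rightarrow> 'b::euclidean_space \<Rightarrow> 'b"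
  assumes S: "open S" and lin: "\<And>x. x \<in> S \<Longrightarrow> linear (A x)" and bij: "\<And>x. x \<in> S \<Longrightarrow> bij (A x)"
  shows "(\<And>w. k_smooth_on k S (\<lambda>x. A x w)) \<Longrightarrow> k_smooth_on k S (\<lambda>x. inv (A x) v)"
proof (induction k arbitrary: v)
  case (Suc k)
  define A' where "A' = (\<lambda>x w. frechet_derivative (\<lambda>x. A x w) (at x))"
  have dA: "((\<lambda>x. A x w) has_derivative A' x w) (at x)" if "x \<in> S" for x w
    using k_smooth_on_SucD(1)[OF Suc.prems that] by (simp add: A'_def)
  have IH: "k_smooth_on k S (\<lambda>x. inv (A x) v)" for v
    using Suc by (simp add: k_smooth_on_mono)
  have linA': "A' x w d = (\<Sum>b\<in>Basis. (w \<bullet> b) *\<^sub>R A' x b d)" if "x \<in> S" for x w d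
    by (rule derivative_linear_family[where A=A and A'="A' x", OF S that lin dA[OF that]])
  show ?case
  proof (rule k_smooth_on_SucI[OF S])
    fix x assume x: "x \<in> S"
    have "linear (inv (A x))"
      using bij[OF x] lin[OF x] inj_linear_imp_inv_linear bij_is_inj by blast
    then have "inv (A x) (A' x (inv (A x) v) d) =
      (\<Sum>c\<in>Basis. (A' x (inv (A x) v) d \<bullet> c) *\<^sub>R inv (A x) c)" for d
      by (rule linear_Basis_expansion)
    then have "inv (A x) (A' x (inv (A x) v) d) =
      (\<Sum>c\<in>Basis. ((\<Sum>b\<in>Basis. (inv (A x) v \<bullet> b) *\<^sub>R A' x b d) \<bullet> c) *\<^sub>R inv (A x) c)" for d
      using linA'[OF x, of "inv (A x) v", symmetric] by simp
    then show "((\<lambda>x. inv (A x) v) has_derivative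
      (\<lambda>d. (-1) *\<^sub>R (\<Sum>c\<in>Basis. ((\<Sum>b\<in>Basis. (inv (A x) v \<bullet> b) *\<^sub>R A' x b d) \<bullet> c) *\<^sub>R inv (A x) c))) (at x)"
      using has_derivative_linear_family_inverse[OF S x lin bij dA, of v] by simp
  next
    fix d
    show "k_smooth_on k S (\<lambda>x. (-1) *\<^sub>R
      (\<Sum>c\<in>Basis. ((\<Sum>b\<in>Basis. (inv (A x) v \<bullet> b) *\<^sub>R A' x b d) \<bullet> c) *\<^sub>R inv (A x) c))"
      unfolding A'_def
      by (intro k_smooth_on_sum k_smooth_on_bilinear[OF bounded_bilinear_scaleR]
          k_smooth_on_bilinear[OF bounded_bilinear_inner] k_smooth_on_const S IH
          k_smooth_on_SucD(2)[OF Suc.prems])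
  qed
qed auto

section \<open>Smooth maps on open sets\<close>

lemma smooth_on_subset: "smooth_on S f \<Longrightarrow> open T \<Longrightarrow> T \<subseteq> S \<Longrightarrow> smooth_on T f"
  by (metis smooth_on_iff_k_smooth_on k_smooth_on_subset)

lemma smooth_on_cong: "smooth_on S f \<Longrightarrow> (\<And>x. x \<in> S \<Longrightarrow> f x = g x) \<Longrightarrow> smooth_on S g"
  unfolding smooth_on_iff_k_smooth_on by (blast intro: k_smooth_on_cong)

lemma smooth_on_Union:
  assumes "\<And>x. x \<in> S \<Longrightarrow> \<exists>U. x \<in> U \<and> U \<subseteq> S \<and> smooth_on U f"
  shows "smooth_on S f"
proof -
  have "k_smooth_on k S f" if "\<And>x. x \<in> S \<Longrightarrow> \<exists>U. x \<in> U \<and> k_smooth_on k U f" for k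
    using that
  proof (induction k arbitrary: f)
    case (Suc k)
    show ?case
      unfolding k_smooth_on.simps
    proof (intro conjI ballI allI Suc.IH)
      fix x assume "x \<in> S"
      then obtain U where "x \<in> U" "k_smooth_on (Suc k) U f" using Suc.prems by blast
      then show "f differentiable (at x)"
        and "\<exists>U. x \<in> U \<and> k_smooth_on k U (\<lambda>x. frechet_derivative f (at x) v)" for v
        by auto
    qed
  qed auto
  moreover have "open S"
    using assms by (subst open_subopen) (metis smooth_on_def)
  moreover have "\<exists>U. x \<in> U \<and> k_smooth_on k U f" if "x \<in> S" for x k
    using assms[OF that] by (auto simp: smooth_on_iff_k_smooth_on)
  ultimately show ?thesis
    by (simp add: smooth_on_iff_k_smooth_on)
qed

lemma smooth_on_const: "open S \<Longrightarrow> smooth_on S (\<lambda>x. c)"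
  and smooth_on_linear: "open S \<Longrightarrow> bounded_linear l \<Longrightarrow> smooth_on S l"
  by (simp_all add: smooth_on_iff_k_smooth_on k_smooth_on_const k_smooth_on_linear)

lemma smooth_on_id: "open S \<Longrightarrow> smooth_on S (\<lambda>x. x)"
  by (simp add: smooth_on_linear bounded_linear_ident)

lemma smooth_on_add: "smooth_on S f \<Longrightarrow> smooth_on S g \<Longrightarrow> smooth_on S (\<lambda>x. f x + g x)"
  by (simp add: smooth_on_iff_k_smooth_on k_smooth_on_add)

lemma smooth_on_sum:
  "open S \<Longrightarrow> (\<And>i. i \<in> I \<Longrightarrow> smooth_on S (f i)) \<Longrightarrow> smooth_on S (\<lambda>x. \<Sum>i\<in>I. f i x)"
  by (simp add: smooth_on_iff_k_smooth_on k_smooth_on_sum)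

lemma smooth_on_bilinear:
  "bounded_bilinear B \<Longrightarrow> smooth_on S f \<Longrightarrow> smooth_on S g \<Longrightarrow> smooth_on S (\<lambda>x. B (f x) (g x))"
  by (simp add: smooth_on_iff_k_smooth_on k_smooth_on_bilinear)

lemmas smooth_on_scaleR = smooth_on_bilinear[OF bounded_bilinear_scaleR]
  and smooth_on_inner = smooth_on_bilinear[OF bounded_bilinear_inner]

lemma smooth_on_compose:
  "smooth_on T f \<Longrightarrow> smooth_on S g \<Longrightarrow> (\<And>x. x \<in> S \<Longrightarrow> g x \<in> T) \<Longrightarrow> smooth_on S (\<lambda>x. f (g x))"
  unfolding smooth_on_iff_k_smooth_on by (blast intro: k_smooth_on_compose)

lemma smooth_on_linear_compose: "bounded_linear l \<Longrightarrow> smooth_on S g \<Longrightarrow> smooth_on S (\<lambda>x. l (g x))"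
  using smooth_on_compose[of UNIV l S g] by (simp add: smooth_on_linear)

lemma smooth_on_diff: "smooth_on S f \<Longrightarrow> smooth_on S g \<Longrightarrow> smooth_on S (\<lambda>x. f x - g x)"
  using smooth_on_add[of S f "\<lambda>x. - g x"]
  by (simp add: smooth_on_linear_compose bounded_linear_minus bounded_linear_ident)

lemma smooth_on_has_derivative:
  "smooth_on S f \<Longrightarrow> x \<in> S \<Longrightarrow> (f has_derivative frechet_derivative f (at x)) (at x)"
  unfolding smooth_on_iff_k_smooth_on by (blast intro: k_smooth_on_SucD(1))

lemma smooth_on_derivative: "smooth_on S f \<Longrightarrow> smooth_on S (\<lambda>x. frechet_derivative f (at x) v)"
  unfolding smooth_on_iff_k_smooth_on by (blast intro: k_smooth_on_SucD(2))

lemma smooth_on_imp_continuous_on: "smooth_on S f \<Longrightarrow> continuous_on S f"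
  by (meson continuous_at_imp_continuous_on has_derivative_continuous smooth_on_has_derivative)

lemma open_preimage_smooth_on:
  assumes "smooth_on S f" "open T"
  shows "open {x \<in> S. f x \<in> T}"
proof -
  have "open (S \<inter> f -` T)"
    using assms(1)
    by (intro continuous_open_preimage smooth_on_imp_continuous_on assms) (simp add: smooth_on_def)
  then show ?thesis by (simp add: Int_def vimage_def)
qed

section \<open>The smooth inverse function theorem and embeddings\<close>

text \<open>\<open>inverse_function_theorem\<close> supplies a differentiable inverse
  \<open>g\<close> with derivative \<open>inv (D (g y))\<close>. This is a smooth family of inverses
  composed with \<open>g\<close>, so each order of smoothness of \<open>g\<close> yields the
  next.\<close>

lemma smooth_inverse_function:
  fixes f :: "'a::euclidean_space \<Rightarrow> 'a"
  assumes f: "smooth_on S f" and x0: "x0 \<in> S" and inj: "inj (frechet_derivative f (at x0))"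
  obtains U V g where "open U" "x0 \<in> U" "U \<subseteq> S" "open V" "f x0 \<in> V" "smooth_on V g"
    "\<And>x. x \<in> U \<Longrightarrow> f x \<in> V \<and> g (f x) = x" "\<And>y. y \<in> V \<Longrightarrow> g y \<in> U \<and> f (g y) = y"
proof -
  define D where "D = (\<lambda>x. frechet_derivative f (at x))"
  have der: "(f has_derivative D x) (at x)" if "x \<in> S" for x
    using smooth_on_has_derivative[OF f that] by (simp add: D_def)
  then have bl: "bounded_linear (D x)" if "x \<in> S" for x
    using that has_derivative_bounded_linear by blast
  obtain l where l: "linear l" "l \<circ> D x0 = id"
    using linear_injective_left_inverse[OF _ inj] bl[OF x0]
    by (auto simp: D_def bounded_linear.linear)
  have op: "open S" using f by (simp add: smooth_on_def)
  obtain U V g g' where U: "open U" "U \<subseteq> S" "x0 \<in> U" and V: "open V" "f x0 \<in> V"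
    and h: "homeomorphism U V f g"
    and dg: "\<And>y. y \<in> V \<Longrightarrow> (g has_derivative g' y) (at y)"
    and g': "\<And>y. y \<in> V \<Longrightarrow> g' y = inv (blinfun_apply (Blinfun (D (g y))))"
    and bij: "\<And>y. y \<in> V \<Longrightarrow> bij (blinfun_apply (Blinfun (D (g y))))"
  proof (rule inverse_function_theorem[of S f "\<lambda>x. Blinfun (D x)" x0 "Blinfun l"])
    show "continuous_on S (\<lambda>x. Blinfun (D x))"
    proof (rule continuous_on_blinfun_componentwise)
      fix i :: 'a
      have "continuous_on S (\<lambda>x. D x i)"
        unfolding D_def using f by (intro smooth_on_imp_continuous_on smooth_on_derivative)
      then show "continuous_on S (\<lambda>x. blinfun_apply (Blinfun (D x)) i)"
        by (rule continuous_on_eq) (simp add: bl bounded_linear_Blinfun_apply)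
    qed
    show "Blinfun l o\<^sub>L Blinfun (D x0) = id_blinfun"
      using l bl[OF x0]
      by (intro blinfun_eqI) (simp add: bounded_linear_Blinfun_apply linear_conv_bounded_linear pointfree_idE)
  qed (use der bl op x0 in \<open>auto simp: bounded_linear_Blinfun_apply\<close>)
  have gU: "g y \<in> U" if "y \<in> V" for y using h that by (auto simp: homeomorphism_def)
  then have gS: "g y \<in> S" if "y \<in> V" for y using that U by blast
  have bijD: "bij (D x)" if "x \<in> U" for x
  proof -
    have "f x \<in> V" "g (f x) = x" using h that by (auto simp: homeomorphism_def)
    then show ?thesis
      using bij[of "f x"] bl[of x] that U by (auto simp: bounded_linear_Blinfun_apply)
  qed
  have dg': "(g has_derivative (\<lambda>v. inv (D (g y)) v)) (at y)" if "y \<in> V" for y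
    using dg[OF that] g'[OF that] bl[OF gS[OF that]] by (simp add: bounded_linear_Blinfun_apply)
  have invD: "k_smooth_on k U (\<lambda>x. inv (D x) v)" for k v
  proof (rule k_smooth_on_linear_family_inverse[OF U(1) _ bijD])
    show "linear (D x)" if "x \<in> U" for x
      using bl that U(2) by (blast intro: bounded_linear.linear)
    show "k_smooth_on k U (\<lambda>x. D x w)" for w
      using smooth_on_subset[OF smooth_on_derivative[OF f] U(1,2)]
      by (simp add: D_def smooth_on_iff_k_smooth_on)
  qed
  have "k_smooth_on k V g" for k
  proof (induction k)
    case (Suc k)
    show ?case
      using k_smooth_on_compose[OF V(1) U(1) gU invD Suc]
      by (intro k_smooth_on_SucI[OF V(1) dg']) auto
  qed auto
  then have "smooth_on V g" using V by (simp add: smooth_on_iff_k_smooth_on)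
  moreover have "f x \<in> V \<and> g (f x) = x" if "x \<in> U" for x
    using h that by (auto simp: homeomorphism_def)
  moreover have "g y \<in> U \<and> f (g y) = y" if "y \<in> V" for y
    using h that by (auto simp: homeomorphism_def)
  ultimately show thesis using that U V by blast
qed

lemma smooth_embedding_vimage_open:
  assumes "smooth_embedding T" "open U"
  obtains W where "open W" "T -` W = U"
proof -
  have inj: "inj T" and c: "continuous_on (range T) (inv T)"
    using assms(1) by (auto simp: smooth_embedding_def)
  obtain W where W: "open W" "W \<inter> range T = inv T -` U \<inter> range T"
    using c assms(2) unfolding continuous_on_open_invariant by blast
  then have "T x \<in> W \<longleftrightarrow> x \<in> U" for x
    using inj by (metis IntD1 IntD2 IntI inv_f_f rangeI vimageD vimageI)
  then show thesis using that[of W] W by blast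
qed

text \<open>A linear left inverse \<open>l\<close> of the derivative at \<open>x0\<close> turns
  \<open>T\<close> into a map of the source space into itself, to which the inverse function theorem
  applies; the local inverse after \<open>l\<close> undoes \<open>T\<close>.\<close>

lemma smooth_embedding_local_left_inverse:
  fixes T :: "'a::euclidean_space \<Rightarrow> 'b::euclidean_space"
  assumes T: "smooth_embedding T"
  obtains H h where "open H" "T x0 \<in> H" "smooth_on H h" "\<And>x. T x \<in> H \<Longrightarrow> h (T x) = x"
proof -
  define D where "D = frechet_derivative T (at x0)"
  have sm: "smooth_on UNIV T" and "inj D"
    using T by (auto simp: smooth_embedding_def smooth_def D_def)
  then have der: "(T has_derivative D) (at x0)"
    using smooth_on_has_derivative D_def by blast
  then obtain l where l: "linear l" "l \<circ> D = id"
    using linear_injective_left_inverse[OF _ \<open>inj D\<close>] has_derivative_linear by blast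
  then have bl: "bounded_linear l" by (simp add: linear_conv_bounded_linear)
  have "((\<lambda>x. l (T x)) has_derivative (\<lambda>v. l (D v))) (at x0)"
    using bounded_linear.has_derivative[OF bl der] .
  from frechet_derivative_at[OF this] have "frechet_derivative (\<lambda>x. l (T x)) (at x0) = l \<circ> D"
    by (simp add: comp_def)
  then have inj: "inj (frechet_derivative (\<lambda>x. l (T x)) (at x0))" using l by simp
  obtain U V g where U: "open U" "x0 \<in> U"
    and V: "open V" "l (T x0) \<in> V" "smooth_on V g"
    and g: "\<And>x. x \<in> U \<Longrightarrow> g (l (T x)) = x"
    using smooth_inverse_function[OF smooth_on_linear_compose[OF bl sm] UNIV_I inj] by metis
  \<comment> \<open>This uses that \<open>T\<close> is an embedding and not just an immersion:
    \<open>W\<close> excludes every \<open>T x\<close> with \<open>x\<close> outside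
    \<open>U\<close>.\<close>
  obtain W where W: "open W" "T -` W = U"
    using smooth_embedding_vimage_open[OF T U(1)] .
  define H where "H = W \<inter> l -` V"
  have "open H"
    unfolding H_def using W(1) V(1) bl by (intro open_Int open_vimage) (auto simp: linear_continuous_on)
  moreover have "smooth_on H (\<lambda>y. g (l y))"
    by (rule smooth_on_compose[OF V(3) smooth_on_linear[OF \<open>open H\<close> bl]]) (simp add: H_def)
  ultimately show thesis
    using that[of H "\<lambda>y. g (l y)"] U V W g by (auto simp: H_def)
qed

text \<open>\<open>smooth_map_on\<close> asks for local extensions to open sets, and the local left
  inverses of \<open>T\<close> are such extensions of its inverse. Hence \<open>X\<close> may be any
  set, for instance a preimage or a fiber.\<close>

lemma diffeo_betw_smooth_embedding:
  assumes T: "smooth_embedding T"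
  shows "diffeo_betw T X (T ` X)"
  unfolding diffeo_betw_def
proof (intro conjI)
  have inj: "inj_on T X" using T by (auto simp: smooth_embedding_def intro: inj_on_subset)
  then show "bij_betw T X (T ` X)" by (rule inj_on_imp_bij_betw)
  show "smooth_map_on X T"
    using T unfolding smooth_map_on_def smooth_embedding_def smooth_def by blast
  show "smooth_map_on (T ` X) (inv_into X T)"
    unfolding smooth_map_on_def
  proof (intro ballI)
    fix y assume "y \<in> T ` X"
    then obtain x0 where "y = T x0" "x0 \<in> X" by blast
    then obtain H h where H: "y \<in> H" "smooth_on H h" "\<And>x. T x \<in> H \<Longrightarrow> h (T x) = x"
      using smooth_embedding_local_left_inverse[OF T] by metis
    then show "\<exists>U h. y \<in> U \<and> smooth_on U h \<and> (\<forall>y\<in>T ` X \<inter> U. h y = inv_into X T y)"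
      using inj by (intro exI[of _ H] exI[of _ h]) auto
  qed
qed

lemma homeomorphism_smooth_embedding:
  assumes "smooth_embedding T"
  shows "homeomorphism A (T ` A) T (inv T)"
proof -
  have "continuous_on UNIV T" and c: "continuous_on (range T) (inv T)" and "inj T"
    using assms smooth_on_imp_continuous_on by (auto simp: smooth_embedding_def smooth_def)
  then show ?thesis
    unfolding homeomorphism_def
    by (auto intro: continuous_on_subset simp: image_image)
qed

section \<open>Submanifolds and local retractions\<close>

lemma projection_along_exists:
  fixes K N :: "'a::euclidean_space set"
  assumes K: "subspace K" and N: "subspace N" and int: "K \<inter> N \<subseteq> {0}"
    and sum: "\<And>v. \<exists>k\<in>K. \<exists>n\<in>N. v = k + n"
  obtains P where "linear P" "\<And>v. P v \<in> N" "\<And>v. v - P v \<in> K"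
    "\<And>v. v \<in> N \<Longrightarrow> P v = v" "\<And>v. P v = 0 \<longleftrightarrow> v \<in> K"
proof -
  have "\<exists>n. n \<in> N \<and> v - n \<in> K" for v
    using sum[of v] by (metis add_diff_cancel_right')
  then obtain P where PN: "\<And>v. P v \<in> N" and PK: "\<And>v. v - P v \<in> K" by metis
  have uniq: "P v = n" if "n \<in> N" "v - n \<in> K" for v n
  proof -
    have "P v - n \<in> N" using that PN N by (simp add: subspace_diff)
    moreover have "(v - n) - (v - P v) \<in> K" using that PK K subspace_diff by blast
    ultimately show ?thesis using int by auto
  qed
  have "linear P"
  proof (rule linearI)
    fix v w c
    show "P (v + w) = P v + P w"
    proof (rule uniq)
      have "(v - P v) + (w - P w) \<in> K" using PK K subspace_add by blast
      then show "v + w - (P v + P w) \<in> K" by (simp add: algebra_simps)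
    qed (use PN N subspace_add in blast)
    show "P (c *\<^sub>R v) = c *\<^sub>R P v"
    proof (rule uniq)
      have "c *\<^sub>R (v - P v) \<in> K" using PK K subspace_scale by blast
      then show "c *\<^sub>R v - c *\<^sub>R P v \<in> K" by (simp add: algebra_simps)
    qed (use PN N subspace_scale in blast)
  qed
  moreover have "P v = v" if "v \<in> N" for v using uniq[OF that] K by (simp add: subspace_0)
  moreover have "P v = 0 \<longleftrightarrow> v \<in> K" for v
    using uniq[of 0 v] PK[of v] N by (auto simp: subspace_0)
  ultimately show thesis using that PN PK by blast
qed

lemma orthogonal_projection_exists:
  fixes L :: "'a::euclidean_space set"
  assumes L: "subspace L"
  obtains P where "linear P" "\<And>v. P v \<in> L" "\<And>v l. l \<in> L \<Longrightarrow> (v - P v) \<bullet> l = 0"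
    "\<And>v. v \<in> L \<Longrightarrow> P v = v" "\<And>v. \<forall>l\<in>L. v \<bullet> l = 0 \<Longrightarrow> P v = 0"
proof -
  define K where "K = {v. \<forall>l\<in>L. v \<bullet> l = 0}"
  have K: "subspace K" unfolding K_def subspace_def by (auto simp: inner_add_left)
  have dec: "\<exists>k\<in>K. \<exists>n\<in>L. v = k + n" for v
  proof -
    obtain y z where "y \<in> span L" "\<And>w. w \<in> span L \<Longrightarrow> orthogonal z w" "v = y + z"
      using orthogonal_subspace_decomp_exists[of L v] by metis
    then have "z \<in> K" "y \<in> L" "v = z + y"
      using L by (auto simp: K_def orthogonal_def span_eq_iff[THEN iffD2, OF L])
    then show ?thesis by blast
  qed
  have int: "K \<inter> L \<subseteq> {0}" by (auto simp: K_def)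
  obtain P where "linear P" "\<And>v. P v \<in> L" "\<And>v. v - P v \<in> K"
    "\<And>v. v \<in> L \<Longrightarrow> P v = v" "\<And>v. P v = 0 \<longleftrightarrow> v \<in> K"
    using projection_along_exists[OF K L int dec] by metis
  then show thesis using that[of P] by (auto simp: K_def)
qed

text \<open>Projections onto complements \<open>N1 \<subseteq> K2\<close> of \<open>K1\<close> and \<open>N2 \<subseteq> K1\<close> of \<open>K2\<close>, so that the mixed products vanish.\<close>

lemma transversal_projections_exist:
  fixes K1 K2 :: "'a::euclidean_space set"
  assumes K: "subspace K1" "subspace K2" and sum: "\<And>v. \<exists>a\<in>K1. \<exists>b\<in>K2. v = a + b"
  obtains P1 P2 where "linear P1" "linear P2" "\<And>v. P1 (P1 v) = P1 v" "\<And>v. P2 (P2 v) = P2 v"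
    "\<And>v. P1 (P2 v) = 0" "\<And>v. P2 (P1 v) = 0" "\<And>v. P1 v = 0 \<longleftrightarrow> v \<in> K1" "\<And>v. P2 v = 0 \<longleftrightarrow> v \<in> K2"
proof -
  define I where "I = K1 \<inter> K2"
  have I: "subspace I" using K by (simp add: I_def subspace_inter)
  obtain Q where Q: "\<And>v. Q v \<in> I" "\<And>v l. l \<in> I \<Longrightarrow> (v - Q v) \<bullet> l = 0"
    using orthogonal_projection_exists[OF I] by metis
  have ex: "\<exists>P. linear P \<and> (\<forall>v. P v \<in> B) \<and> (\<forall>v. P (P v) = P v) \<and> (\<forall>v. P v = 0 \<longleftrightarrow> v \<in> A)"
    if A: "subspace A" and B: "subspace B" and AB: "A \<inter> B = I" and s: "\<And>v. \<exists>a\<in>A. \<exists>b\<in>B. v = a + b" for A B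
  proof -
    \<comment> \<open>The complement of \<open>A\<close> is the part of \<open>B\<close> orthogonal
      to \<open>I\<close>: in a decomposition \<open>a + b\<close> the component \<open>Q b\<close>
      lies in both subspaces and is moved over to \<open>a\<close>.\<close>
    define N where "N = {v\<in>B. \<forall>l\<in>I. v \<bullet> l = 0}"
    have N: "subspace N" using B unfolding N_def subspace_def by (auto simp: inner_add_left)
    have "x \<bullet> x = 0" if "x \<in> A \<inter> N" for x using that AB unfolding N_def by blast
    then have int: "A \<inter> N \<subseteq> {0}" by auto
    have dec: "\<exists>k\<in>A. \<exists>n\<in>N. v = k + n" for v
    proof -
      obtain a b where ab: "a \<in> A" "b \<in> B" "v = a + b" using s by blast
      have "Q b \<in> A" "Q b \<in> B" using Q AB by blast+
      then have "a + Q b \<in> A" "b - Q b \<in> N" "v = (a + Q b) + (b - Q b)"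
        using ab A B Q by (auto simp: N_def subspace_add subspace_diff)
      then show ?thesis by blast
    qed
    obtain P where "linear P" "\<And>v. P v \<in> N" "\<And>v. v \<in> N \<Longrightarrow> P v = v" "\<And>v. P v = 0 \<longleftrightarrow> v \<in> A"
      using projection_along_exists[OF A N int dec] by metis
    then show ?thesis by (auto simp: N_def)
  qed
  obtain P1 where P1: "linear P1" "\<And>v. P1 v \<in> K2" "\<And>v. P1 (P1 v) = P1 v" "\<And>v. P1 v = 0 \<longleftrightarrow> v \<in> K1"
    using ex[OF K _ sum] I_def by blast
  have "\<exists>b\<in>K2. \<exists>a\<in>K1. v = b + a" for v using sum[of v] by (metis add.commute)
  then obtain P2 where P2: "linear P2" "\<And>v. P2 v \<in> K1" "\<And>v. P2 (P2 v) = P2 v" "\<And>v. P2 v = 0 \<longleftrightarrow> v \<in> K2"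
    using ex[OF K(2,1)] I_def by blast
  show thesis using that[of P1 P2] P1 P2 by blast
qed

section \<open>Charts and defining maps of submanifolds\<close>

lemma submanifold_chart:
  fixes M :: "'a::euclidean_space set"
  assumes "submanifold M" "p \<in> M"
  obtains U V L and \<phi> \<psi> :: "'a \<Rightarrow> 'a" where "open U" "p \<in> U" "open V" "smooth_on U \<phi>" "smooth_on V \<psi>"
    "\<And>x. x \<in> U \<Longrightarrow> \<phi> x \<in> V \<and> \<psi> (\<phi> x) = x" "\<And>y. y \<in> V \<Longrightarrow> \<psi> y \<in> U \<and> \<phi> (\<psi> y) = y"
    "subspace L" "\<And>x. x \<in> U \<Longrightarrow> x \<in> M \<longleftrightarrow> \<phi> x \<in> L"
    "\<And>x v. x \<in> U \<Longrightarrow> frechet_derivative \<psi> (at (\<phi> x)) (frechet_derivative \<phi> (at x) v) = v"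
    "\<And>x v. x \<in> U \<Longrightarrow> frechet_derivative \<phi> (at x) (frechet_derivative \<psi> (at (\<phi> x)) v) = v"
proof -
  obtain U V \<phi> \<psi> and L :: "'a set" where U: "open U" "p \<in> U" and V: "open V"
    and sm: "smooth_on U \<phi>" "smooth_on V \<psi>"
    and im: "\<phi> ` U = V" and inv1: "\<And>x. x \<in> U \<Longrightarrow> \<psi> (\<phi> x) = x" and inv2: "\<And>y. y \<in> V \<Longrightarrow> \<phi> (\<psi> y) = y"
    and L: "subspace L" "\<phi> ` (M \<inter> U) = V \<inter> L"
    using assms unfolding submanifold_def by metis
  have chain: "frechet_derivative g (at (h x)) (frechet_derivative h (at x) v) = v"
    if gh: "smooth_on A h" "smooth_on B g" "h x \<in> B" "x \<in> A" "\<And>x. x \<in> A \<Longrightarrow> g (h x) = x"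
    for A B :: "'a set" and g h x v
  proof -
    have "((\<lambda>x. g (h x)) has_derivative (\<lambda>v. frechet_derivative g (at (h x)) (frechet_derivative h (at x) v))) (at x)"
      using has_derivative_compose[OF smooth_on_has_derivative[OF gh(1,4)] smooth_on_has_derivative[OF gh(2,3)]] .
    moreover have "open A" using gh(1) by (simp add: smooth_on_def)
    ultimately have "((\<lambda>x. x) has_derivative (\<lambda>v. frechet_derivative g (at (h x)) (frechet_derivative h (at x) v))) (at x)"
      by (rule has_derivative_transform_within_open) (use gh in auto)
    from has_derivative_unique[OF this has_derivative_ident] show ?thesis by (rule fun_cong)
  qed
  have mem: "x \<in> M \<longleftrightarrow> \<phi> x \<in> L" if "x \<in> U" for x
  proof
    assume "\<phi> x \<in> L"
    then have "\<phi> x \<in> \<phi> ` (M \<inter> U)" unfolding L(2) using that im by blast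
    then obtain m where "m \<in> M" "m \<in> U" "\<phi> x = \<phi> m" by blast
    moreover from this have "x = m" using inv1[OF that] inv1[OF \<open>m \<in> U\<close>] by metis
    ultimately show "x \<in> M" by blast
  qed (use that L in blast)
  have \<phi>V: "\<phi> x \<in> V" if "x \<in> U" for x using that im by blast
  have \<psi>U: "\<psi> y \<in> U" if "y \<in> V" for y using that im inv1 by force
  show thesis
  proof (rule that[of U V \<phi> \<psi> L])
    fix x v assume x: "x \<in> U"
    show "frechet_derivative \<psi> (at (\<phi> x)) (frechet_derivative \<phi> (at x) v) = v"
      using chain[OF sm \<phi>V[OF x] x inv1] .
    have "\<psi> (\<phi> x) \<in> U" using x inv1 by simp
    from chain[OF sm(2,1) this \<phi>V[OF x] inv2]
    show "frechet_derivative \<phi> (at x) (frechet_derivative \<psi> (at (\<phi> x)) v) = v"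
      using inv1[OF x] by simp
  qed (use U V sm inv1 inv2 L mem \<phi>V \<psi>U in blast)+
qed

text \<open>The chart is normalised to have value 0 and identity derivative at \<open>p\<close>, so
  that the defining maps of two submanifolds can be blended by projections and still have identity
  derivative. As \<open>set_sum\<close> is monotone, the inclusion of the tangent space in
  \<open>K\<close> carries transversality over to the model subspaces.\<close>

lemma submanifold_defining_map:
  fixes M :: "'a::euclidean_space set"
  assumes "submanifold M" "p \<in> M"
  obtains U K and A :: "'a \<Rightarrow> 'a" where "open U" "p \<in> U" "smooth_on U A" "subspace K" "\<And>x. x \<in> U \<Longrightarrow> x \<in> M \<longleftrightarrow> A x \<in> K"
    "A p = 0" "(A has_derivative (\<lambda>v. v)) (at p)" "tangent_space M p \<subseteq> K"
proof -
  obtain U V L and \<phi> \<psi> :: "'a \<Rightarrow> 'a" where U: "open U" "p \<in> U" and V: "open V" and sm: "smooth_on U \<phi>" "smooth_on V \<psi>"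
    and c: "\<And>x. x \<in> U \<Longrightarrow> \<phi> x \<in> V \<and> \<psi> (\<phi> x) = x"
    and L: "subspace L" and mem: "\<And>x. x \<in> U \<Longrightarrow> x \<in> M \<longleftrightarrow> \<phi> x \<in> L"
    and d1: "\<And>x v. x \<in> U \<Longrightarrow> frechet_derivative \<psi> (at (\<phi> x)) (frechet_derivative \<phi> (at x) v) = v"
    and d2: "\<And>x v. x \<in> U \<Longrightarrow> frechet_derivative \<phi> (at x) (frechet_derivative \<psi> (at (\<phi> x)) v) = v"
    using submanifold_chart[OF assms] by metis
  define J where "J = frechet_derivative \<psi> (at (\<phi> p))"
  define A where "A = (\<lambda>x. J (\<phi> x - \<phi> p))"
  define K where "K = J ` L"
  have J: "bounded_linear J"
    unfolding J_def using smooth_on_has_derivative[OF sm(2)] c U has_derivative_bounded_linear by blast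
  have K: "subspace K"
    unfolding K_def using J L by (simp add: linear_subspace_image bounded_linear.linear)
  have Jmem: "J w \<in> K \<longleftrightarrow> w \<in> L" for w
    unfolding K_def using d2[OF U(2)] by (metis J_def image_iff)
  have smA: "smooth_on U A"
    unfolding A_def using U sm by (intro smooth_on_linear_compose[OF J] smooth_on_diff smooth_on_const)
  have pL: "\<phi> p \<in> L" using mem U assms by blast
  have memA: "x \<in> M \<longleftrightarrow> A x \<in> K" if "x \<in> U" for x
    unfolding A_def Jmem mem[OF that] using pL L
    by (metis diff_add_cancel subspace_add subspace_diff)
  have "((\<lambda>x. \<phi> x - \<phi> p) has_derivative frechet_derivative \<phi> (at p)) (at p)"
    using smooth_on_has_derivative[OF sm(1) U(2)] by (auto intro!: derivative_eq_intros)
  from bounded_linear.has_derivative[OF J this]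
  have dA: "(A has_derivative (\<lambda>v. v)) (at p)"
    unfolding A_def using d1[OF U(2)] by (simp add: J_def)
  obtain P where P: "linear P" "\<And>v. P v \<in> K" "\<And>v. v \<in> K \<Longrightarrow> P v = v"
    using orthogonal_projection_exists[OF K] by metis
  have "tangent_space M p \<subseteq> K"
  proof
    fix v assume "v \<in> tangent_space M p"
    then obtain \<gamma> :: "real \<Rightarrow> 'a" where \<gamma>: "\<gamma> 0 = p" "\<And>t. \<gamma> t \<in> M" "(\<gamma> has_derivative (\<lambda>t. t *\<^sub>R v)) (at 0)"
      by (auto simp: tangent_space_def has_vector_derivative_def)
    have "((\<lambda>t. A (\<gamma> t)) has_derivative (\<lambda>t. t *\<^sub>R v)) (at 0)"
      using has_derivative_compose[OF \<gamma>(3), of A "\<lambda>v. v"] dA \<gamma>(1) by simp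
    moreover from this have "((\<lambda>t. P (A (\<gamma> t))) has_derivative (\<lambda>t. P (t *\<^sub>R v))) (at 0)"
      using P(1) bounded_linear.has_derivative linear_conv_bounded_linear by blast
    \<comment> \<open>The curve lies in \<open>M\<close>, so near 0 it is sent into \<open>K\<close>
      by \<open>A\<close> and this difference vanishes. Its derivative is then zero, which at 1
      reads \<open>v - P v = 0\<close>.\<close>
    ultimately have D: "((\<lambda>t. A (\<gamma> t) - P (A (\<gamma> t))) has_derivative (\<lambda>t. t *\<^sub>R v - P (t *\<^sub>R v))) (at 0)"
      by (rule has_derivative_diff)
    have "(\<gamma> \<longlongrightarrow> p) (at 0)"
      using has_derivative_continuous[OF \<gamma>(3)] \<gamma>(1) by (simp add: isCont_def)
    then have "\<forall>\<^sub>F t in at 0. \<gamma> t \<in> U" using U by (simp add: topological_tendstoD)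
    then have ev: "\<forall>\<^sub>F t in at 0. A (\<gamma> t) - P (A (\<gamma> t)) = 0"
      by eventually_elim (metis memA \<gamma>(2) P(3) diff_self)
    moreover have "A (\<gamma> 0) - P (A (\<gamma> 0)) = 0" by (metis memA U(2) \<gamma>(1,2) P(3) diff_self)
    ultimately have "((\<lambda>t. 0) has_derivative (\<lambda>t. t *\<^sub>R v - P (t *\<^sub>R v))) (at 0)"
      using has_derivative_transform_eventually[OF D] by auto
    from has_derivative_unique[OF this has_derivative_const]
    have "1 *\<^sub>R v - P (1 *\<^sub>R v) = 0" by (rule fun_cong)
    then show "v \<in> K" using P(2)[of v] by simp
  qed
  then show thesis
    using that[OF U smA K memA _ dA] J by (simp add: A_def bounded_linear.linear linear_0)
qed

text \<open>A local diffeomorphism \<open>\<Theta>\<close> straightens \<open>M\<close> and \<open>Z\<close> simultaneously to the kernels of \<open>P1\<close> and \<open>P2\<close>;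
  the retraction is the linear projection \<open>id - P2\<close> in these coordinates.\<close>

lemma transversal_local_retraction:
  fixes M Z :: "'a::euclidean_space set"
  assumes M: "submanifold M" "p \<in> M" and Z: "submanifold Z" "p \<in> Z"
    and trans: "set_sum (tangent_space M p) (tangent_space Z p) = UNIV"
  obtains W r where "open W" "p \<in> W" "smooth_on W r" "\<And>x. x \<in> W \<Longrightarrow> r x \<in> Z"
    "\<And>x. x \<in> W \<Longrightarrow> x \<in> Z \<Longrightarrow> r x = x" "\<And>x. x \<in> W \<Longrightarrow> x \<in> M \<Longrightarrow> r x \<in> M"
    "\<And>x. x \<in> W \<Longrightarrow> r x = p \<Longrightarrow> x \<in> M"
proof -
  obtain U1 A1 K1 where 1: "open U1" "p \<in> U1" "smooth_on U1 A1" "subspace K1"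
    and mem1: "\<And>x. x \<in> U1 \<Longrightarrow> x \<in> M \<longleftrightarrow> A1 x \<in> K1"
    and D1: "A1 p = 0" "(A1 has_derivative (\<lambda>v. v)) (at p)" "tangent_space M p \<subseteq> K1"
    using submanifold_defining_map[OF M] by metis
  obtain U2 A2 K2 where 2: "open U2" "p \<in> U2" "smooth_on U2 A2" "subspace K2"
    and mem2: "\<And>x. x \<in> U2 \<Longrightarrow> x \<in> Z \<longleftrightarrow> A2 x \<in> K2"
    and D2: "A2 p = 0" "(A2 has_derivative (\<lambda>v. v)) (at p)" "tangent_space Z p \<subseteq> K2"
    using submanifold_defining_map[OF Z] by metis
  have sum: "\<exists>a\<in>K1. \<exists>b\<in>K2. v = a + b" for v
  proof -
    have "v \<in> set_sum (tangent_space M p) (tangent_space Z p)" using trans by simp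
    then show ?thesis using D1(3) D2(3) unfolding set_sum_def by blast
  qed
  obtain P1 P2 where lin: "linear P1" "linear P2"
    and P: "\<And>v. P1 (P1 v) = P1 v" "\<And>v. P2 (P2 v) = P2 v" "\<And>v. P1 (P2 v) = 0" "\<And>v. P2 (P1 v) = 0"
    and ker: "\<And>v. P1 v = 0 \<longleftrightarrow> v \<in> K1" "\<And>v. P2 v = 0 \<longleftrightarrow> v \<in> K2"
    by (rule transversal_projections_exist[OF 1(4) 2(4) sum]) (rule that)
  have bl: "bounded_linear P1" "bounded_linear P2" using lin by (auto simp: linear_conv_bounded_linear)
  \<comment> \<open>The \<open>P1\<close> and \<open>P2\<close> parts of \<open>x - p\<close> are
    exchanged for those of the defining maps. Since \<open>A1\<close> and \<open>A2\<close> have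
    identity derivative at \<open>p\<close>, so does \<open>\<Theta>\<close>.\<close>
  define \<Theta> where "\<Theta> = (\<lambda>x. (x - p) - P1 (x - p) - P2 (x - p) + P1 (A1 x) + P2 (A2 x))"
  define U where "U = U1 \<inter> U2"
  have U: "open U" "p \<in> U" using 1 2 by (auto simp: U_def)
  have sA: "smooth_on U A1" "smooth_on U A2"
    using 1 2 U smooth_on_subset[of U1 A1 U] smooth_on_subset[of U2 A2 U] by (auto simp: U_def)
  have sm: "smooth_on U \<Theta>"
    unfolding \<Theta>_def using U(1) sA
    by (intro smooth_on_add smooth_on_diff smooth_on_linear_compose[OF bl(1)] smooth_on_linear_compose[OF bl(2)]
        smooth_on_id smooth_on_const)
  have "(\<Theta> has_derivative (\<lambda>v. v - P1 v - P2 v + P1 v + P2 v)) (at p)"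
    unfolding \<Theta>_def
    by (intro has_derivative_add has_derivative_diff bounded_linear.has_derivative[OF bl(1)]
        bounded_linear.has_derivative[OF bl(2)] D1(2) D2(2)) (auto intro!: derivative_eq_intros)
  then have "(\<Theta> has_derivative (\<lambda>v. v)) (at p)" by simp
  from frechet_derivative_at[OF this, symmetric] have inj: "inj (frechet_derivative \<Theta> (at p))"
    by (simp add: inj_def)
  obtain U0 V0 G where U0: "open U0" "p \<in> U0" "U0 \<subseteq> U" and V0: "open V0" "\<Theta> p \<in> V0" "smooth_on V0 G"
    and G1: "\<And>x. x \<in> U0 \<Longrightarrow> \<Theta> x \<in> V0 \<and> G (\<Theta> x) = x" and G2: "\<And>y. y \<in> V0 \<Longrightarrow> G y \<in> U0 \<and> \<Theta> (G y) = y"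
    using smooth_inverse_function[OF sm U(2) inj] by metis
  have \<Theta>p: "\<Theta> p = 0" using lin D1 D2 by (simp add: \<Theta>_def linear_0)
  have P\<Theta>: "P1 (\<Theta> x) = P1 (A1 x)" "P2 (\<Theta> x) = P2 (A2 x)" for x
    unfolding \<Theta>_def by (simp_all add: linear_add[OF lin(1)] linear_diff[OF lin(1)] linear_add[OF lin(2)] linear_diff[OF lin(2)] P)
  have memM: "x \<in> M \<longleftrightarrow> P1 (\<Theta> x) = 0" and memZ: "x \<in> Z \<longleftrightarrow> P2 (\<Theta> x) = 0" if "x \<in> U0" for x
    using that U0 mem1 mem2 by (auto simp: U_def P\<Theta> ker)
  define R where "R = (\<lambda>x. \<Theta> x - P2 (\<Theta> x))"
  define W where "W = {x \<in> U0. R x \<in> V0}"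
  define r where "r = (\<lambda>x. G (R x))"
  have smR: "smooth_on U0 R"
    unfolding R_def using smooth_on_subset[OF sm U0(1,3)]
    by (intro smooth_on_diff smooth_on_linear_compose[OF bl(2)])
  have W: "open W" unfolding W_def using open_preimage_smooth_on[OF smR V0(1)] .
  have WU: "W \<subseteq> U0" by (auto simp: W_def)
  have rU0: "r x \<in> U0" and \<Theta>r: "\<Theta> (r x) = R x" if "x \<in> W" for x
    using that G2 by (auto simp: W_def r_def)
  \<comment> \<open>Subtracting the \<open>P2\<close> part lands in \<open>Z\<close>. Since
    \<open>P1 (P2 v) = 0\<close>, it leaves the \<open>P1\<close> part alone, which decides
    membership in \<open>M\<close>; both properties of \<open>r\<close> concerning \<open>M\<close>
    rest on this.\<close>
  have PR: "P2 (R x) = 0" "P1 (R x) = P1 (\<Theta> x)" for x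
    unfolding R_def by (simp_all add: linear_diff[OF lin(1)] linear_diff[OF lin(2)] P)
  show thesis
  proof (rule that[of W r])
    show "p \<in> W" using U0 V0 \<Theta>p by (simp add: W_def R_def linear_0[OF lin(2)])
    show "smooth_on W r"
      unfolding r_def by (rule smooth_on_compose[OF V0(3) smooth_on_subset[OF smR W WU]]) (simp add: W_def)
    fix x assume x: "x \<in> W"
    then have xU: "x \<in> U0" using WU by blast
    show "r x \<in> Z" using memZ[OF rU0[OF x]] by (simp add: \<Theta>r[OF x] PR)
    show "r x = x" if "x \<in> Z"
      using memZ[OF xU] that G1[OF xU] by (simp add: r_def R_def)
    show "r x \<in> M" if "x \<in> M"
      using memM[OF rU0[OF x]] memM[OF xU] that by (simp add: \<Theta>r[OF x] PR)
    show "x \<in> M" if "r x = p"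
    proof -
      have "P1 (\<Theta> x) = P1 (\<Theta> (r x))" by (simp add: \<Theta>r[OF x] PR)
      then show ?thesis using memM[OF xU] by (simp add: that \<Theta>p linear_0[OF lin(1)])
    qed
  qed (use W in auto)
qed

section \<open>Tubes around submanifolds\<close>

definition is_nearest_point :: "'a::metric_space set \<Rightarrow> 'a \<Rightarrow> 'a \<Rightarrow> bool" where
  "is_nearest_point Z x y \<longleftrightarrow> y \<in> Z \<and> (\<forall>y'\<in>Z. dist x y \<le> dist x y')"

text \<open>\<open>Z\<close> need not be closed, but a chart shows that its trace on a small closed
  ball is; a minimum over that trace is a minimum over \<open>Z\<close> once \<open>x\<close> is
  close to the centre.\<close>

lemma submanifold_nearest_point_exists:
  fixes Z :: "'a::euclidean_space set"
  assumes "submanifold Z" "p \<in> Z"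
  obtains R where "R > 0" "\<And>x. dist p x < R \<Longrightarrow> \<exists>y. is_nearest_point Z x y"
proof -
  obtain U V L and \<phi> \<psi> :: "'a \<Rightarrow> 'a" where U: "open U" "p \<in> U" "smooth_on U \<phi>"
    and L: "subspace L" and mem: "\<And>x. x \<in> U \<Longrightarrow> x \<in> Z \<longleftrightarrow> \<phi> x \<in> L"
    by (rule submanifold_chart[OF assms]) (rule that)
  obtain R where R: "R > 0" "cball p R \<subseteq> U" using U open_contains_cball by blast
  have "closed (cball p R \<inter> \<phi> -` L)"
    using R U L by (intro continuous_closed_preimage continuous_on_subset[OF smooth_on_imp_continuous_on])
      (auto simp: closed_subspace)
  moreover have "cball p R \<inter> \<phi> -` L = Z \<inter> cball p R" using mem R by blast
  ultimately have cl: "closed (Z \<inter> cball p R)" by simp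
  have ne: "Z \<inter> cball p R \<noteq> {}" using R assms by force
  \<comment> \<open>Points of \<open>Z\<close> outside the ball are further than
    \<open>R / 2\<close> from \<open>x\<close>, while \<open>p\<close> is nearer than that.\<close>
  have "\<exists>y. is_nearest_point Z x y" if x: "dist p x < R / 2" for x
  proof -
    obtain y where y: "y \<in> Z \<inter> cball p R" "\<And>y'. y' \<in> Z \<inter> cball p R \<Longrightarrow> dist x y \<le> dist x y'"
      using distance_attains_inf[OF cl ne] by metis
    have "dist x y \<le> dist x y'" if "y' \<in> Z" for y'
    proof (cases "y' \<in> cball p R")
      case False
      then have "dist p y' > R" by simp
      moreover have "dist p y' \<le> dist p x + dist x y'" by (rule dist_triangle)
      moreover have "dist x y \<le> dist x p" using y(2)[of p] R assms by simp
      ultimately show ?thesis using x by (simp add: dist_commute)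
    qed (use y that in blast)
    then show ?thesis using y by (auto simp: is_nearest_point_def)
  qed
  then show thesis using that[of "R / 2"] R by simp
qed

text \<open>First-order condition at \<open>t = 0\<close> for the squared distance along
  \<open>\<psi> (u + t *\<^sub>R l)\<close>, a curve that lies in \<open>Z\<close> for small
  \<open>t\<close>. Squaring keeps it differentiable also at distance 0.\<close>

lemma nearest_point_orthogonal:
  fixes \<psi> :: "'b::euclidean_space \<Rightarrow> 'a::euclidean_space"
  assumes V: "open V" "u \<in> V" and \<psi>: "(\<psi> has_derivative D) (at u)"
    and L: "subspace L" "u \<in> L" "l \<in> L"
    and Z: "\<And>w. w \<in> V \<Longrightarrow> w \<in> L \<Longrightarrow> \<psi> w \<in> Z" and near: "is_nearest_point Z x (\<psi> u)"
  shows "D l \<bullet> (x - \<psi> u) = 0"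
proof -
  define q where "q = (\<lambda>t::real. (x - \<psi> (u + t *\<^sub>R l)) \<bullet> (x - \<psi> (u + t *\<^sub>R l)))"
  have c: "continuous_on UNIV (\<lambda>t::real. u + t *\<^sub>R l)" by (intro continuous_intros)
  define S where "S = (\<lambda>t::real. u + t *\<^sub>R l) -` V"
  have S: "open S" "0 \<in> S" using V c open_vimage by (auto simp: S_def)
  have l: "((\<lambda>t::real. u + t *\<^sub>R l) has_derivative (\<lambda>t. t *\<^sub>R l)) (at 0)"
    by (auto intro!: derivative_eq_intros)
  have "((\<lambda>t::real. \<psi> (u + t *\<^sub>R l)) has_derivative (\<lambda>t. D (t *\<^sub>R l))) (at 0)"
    by (rule has_derivative_compose[OF l]) (use \<psi> in simp)
  then have d: "((\<lambda>t::real. x - \<psi> (u + t *\<^sub>R l)) has_derivative (\<lambda>t. - D (t *\<^sub>R l))) (at 0)"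
    by (auto intro!: derivative_eq_intros)
  have dq: "(q has_derivative (\<lambda>t. (x - \<psi> u) \<bullet> (- D (t *\<^sub>R l)) + (- D (t *\<^sub>R l)) \<bullet> (x - \<psi> u))) (at 0)"
    unfolding q_def using has_derivative_inner[OF d d] by simp
  have "q 0 \<le> q t" if "t \<in> S" for t
  proof -
    have "u + t *\<^sub>R l \<in> L" using L by (simp add: subspace_add subspace_scale)
    then have "\<psi> (u + t *\<^sub>R l) \<in> Z" using Z that by (simp add: S_def)
    then have "norm (x - \<psi> u) \<le> norm (x - \<psi> (u + t *\<^sub>R l))"
      using near by (auto simp: is_nearest_point_def dist_norm)
    then show ?thesis by (simp add: q_def dot_square_norm)
  qed
  then have "(\<lambda>t. (x - \<psi> u) \<bullet> (- D (t *\<^sub>R l)) + (- D (t *\<^sub>R l)) \<bullet> (x - \<psi> u)) = (\<lambda>t. 0)"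
    using differential_zero_maxmin[OF S(2,1) dq] by blast
  from fun_cong[OF this, of 1] show ?thesis by (simp add: inner_commute)
qed

text \<open>In a chart \<open>\<phi>\<close> with inverse \<open>\<psi>\<close>, the normal space at \<open>y\<close> is the image of \<open>L\<^sup>\<bottom>\<close> under the adjoint
  of \<open>D\<phi> y\<close>. Hence \<open>E w = \<psi> (P w) + (D\<phi> (\<psi> (P w)))\<^sup>* (w - P w)\<close> is a normal exponential map,
  and its local inverse \<open>G\<close> determines every nearest point as \<open>\<psi> (P (G x))\<close>. The adjoint is
  written out in the standard basis.\<close>

lemma submanifold_nearest_point_smooth:
  fixes Z :: "'a::euclidean_space set"
  assumes Z: "submanifold Z" and p: "p \<in> Z"
  obtains W r where "p \<in> W" "smooth_on W r" "\<And>x. x \<in> W \<Longrightarrow> is_nearest_point Z x (r x)"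
    "\<And>x y. x \<in> W \<Longrightarrow> is_nearest_point Z x y \<Longrightarrow> y = r x"
proof -
  obtain U V L and \<phi> \<psi> :: "'a \<Rightarrow> 'a" where U: "open U" "p \<in> U" and V: "open V"
    and sm: "smooth_on U \<phi>" "smooth_on V \<psi>"
    and c1: "\<And>x. x \<in> U \<Longrightarrow> \<phi> x \<in> V \<and> \<psi> (\<phi> x) = x" and c2: "\<And>y. y \<in> V \<Longrightarrow> \<psi> y \<in> U \<and> \<phi> (\<psi> y) = y"
    and L: "subspace L" and mem: "\<And>x. x \<in> U \<Longrightarrow> x \<in> Z \<longleftrightarrow> \<phi> x \<in> L"
    and d1: "\<And>x v. x \<in> U \<Longrightarrow> frechet_derivative \<psi> (at (\<phi> x)) (frechet_derivative \<phi> (at x) v) = v"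
    and d2: "\<And>x v. x \<in> U \<Longrightarrow> frechet_derivative \<phi> (at x) (frechet_derivative \<psi> (at (\<phi> x)) v) = v"
    by (rule submanifold_chart[OF Z p]) (rule that)
  obtain P where P: "linear P" "\<And>v. P v \<in> L" "\<And>v l. l \<in> L \<Longrightarrow> (v - P v) \<bullet> l = 0"
    "\<And>v. v \<in> L \<Longrightarrow> P v = v" "\<And>v. \<forall>l\<in>L. v \<bullet> l = 0 \<Longrightarrow> P v = 0"
    by (rule orthogonal_projection_exists[OF L]) (rule that)
  have blP: "bounded_linear P" using P(1) by (simp add: linear_conv_bounded_linear)
  define D\<phi> where "D\<phi> = (\<lambda>x. frechet_derivative \<phi> (at x))"
  define D\<psi> where "D\<psi> = (\<lambda>x. frechet_derivative \<psi> (at x))"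
  have d1: "D\<psi> (\<phi> x) (D\<phi> x v) = v" and d2: "D\<phi> x (D\<psi> (\<phi> x) v) = v" if "x \<in> U" for x v
    using d1[OF that] d2[OF that] by (simp_all add: D\<phi>_def D\<psi>_def)
  have lin\<phi>: "linear (D\<phi> x)" if "x \<in> U" for x
    using smooth_on_has_derivative[OF sm(1) that] by (simp add: D\<phi>_def has_derivative_linear)
  have lin\<psi>: "linear (D\<psi> x)" if "x \<in> V" for x
    using smooth_on_has_derivative[OF sm(2) that] by (simp add: D\<psi>_def has_derivative_linear)
  have adj: "(\<Sum>b\<in>Basis. (D b \<bullet> n) *\<^sub>R b) \<bullet> v = D v \<bullet> n" if "linear D" for D :: "'a \<Rightarrow> 'a" and n v
    by (subst (2) linear_Basis_expansion[OF that]) (simp add: inner_sum_left inner_sum_right inner_commute mult.commute)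
  define u0 where "u0 = \<phi> p"
  have u0: "u0 \<in> V" "u0 \<in> L" "P u0 = u0" "\<psi> u0 = p"
    using U c1 mem p P(4) by (auto simp: u0_def)
  define E where "E = (\<lambda>w. \<psi> (P w) + (\<Sum>b\<in>Basis. (D\<phi> (\<psi> (P w)) b \<bullet> (w - P w)) *\<^sub>R b))"
  define V1 where "V1 = {w \<in> UNIV. P w \<in> V}"
  have V1: "open V1" unfolding V1_def by (rule open_preimage_smooth_on[OF smooth_on_linear[OF open_UNIV blP] V])
  have u0V1: "u0 \<in> V1" using u0 by (simp add: V1_def)
  have smP: "smooth_on V1 P" using V1 blP by (rule smooth_on_linear)
  have smn: "smooth_on V1 (\<lambda>w. w - P w)" using V1 smP by (intro smooth_on_diff smooth_on_id)
  have sm\<psi>P: "smooth_on V1 (\<lambda>w. \<psi> (P w))"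
    by (rule smooth_on_compose[OF sm(2) smP]) (simp add: V1_def)
  have smD: "smooth_on V1 (\<lambda>w. D\<phi> (\<psi> (P w)) b)" for b
    unfolding D\<phi>_def
    by (rule smooth_on_compose[OF smooth_on_derivative[OF sm(1)] sm\<psi>P]) (use c2 in \<open>simp add: V1_def\<close>)
  have smE: "smooth_on V1 E"
    unfolding E_def using V1
    by (intro smooth_on_add sm\<psi>P smooth_on_sum smooth_on_scaleR smooth_on_inner smD smn smooth_on_const)
  define E' where "E' = (\<lambda>w. D\<psi> u0 (P w) + (\<Sum>b\<in>Basis. (D\<phi> p b \<bullet> (w - P w)) *\<^sub>R b))"
  have dP: "(P has_derivative P) (at u0)" using blP by (rule bounded_linear_imp_has_derivative)
  have "((\<lambda>w. w - P w) has_derivative (\<lambda>w. w - P w)) (at u0)"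
    by (intro has_derivative_diff has_derivative_ident dP)
  from has_derivative_inner[OF smooth_on_has_derivative[OF smD u0V1] this]
  have db: "((\<lambda>w. D\<phi> (\<psi> (P w)) b \<bullet> (w - P w)) has_derivative (\<lambda>w. D\<phi> p b \<bullet> (w - P w))) (at u0)" for b
    using u0 by simp
  have d\<psi>: "((\<lambda>w. \<psi> (P w)) has_derivative (\<lambda>w. D\<psi> u0 (P w))) (at u0)"
    by (rule has_derivative_compose[OF dP])
      (use smooth_on_has_derivative[OF sm(2) u0(1)] u0 in \<open>simp add: D\<psi>_def\<close>)
  have dE: "(E has_derivative E') (at u0)"
    unfolding E_def E'_def
    by (intro has_derivative_add d\<psi> has_derivative_sum has_derivative_scaleR_left db)
  \<comment> \<open>The two summands of \<open>E' w\<close> are orthogonal: \<open>c \<bullet> a =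
    D\<phi> p a \<bullet> n = P w \<bullet> n = 0\<close>. So both vanish, and invertibility of the
    derivatives gives \<open>P w = 0\<close> and \<open>n = 0\<close>.\<close>
  have "w = 0" if w: "E' w = 0" for w
  proof -
    define a where "a = D\<psi> u0 (P w)"
    define n where "n = w - P w"
    define c where "c = (\<Sum>b\<in>Basis. (D\<phi> p b \<bullet> n) *\<^sub>R b)"
    have c: "c \<bullet> v = D\<phi> p v \<bullet> n" for v unfolding c_def by (rule adj[OF lin\<phi>[OF U(2)]])
    have ac: "a + c = 0" using w by (simp add: E'_def a_def c_def n_def)
    have D\<phi>a: "D\<phi> p a = P w" unfolding a_def u0_def using d2[OF U(2)] .
    have "c \<bullet> a = 0" using c[of a] D\<phi>a P(2,3) by (simp add: n_def inner_commute)
    moreover have "c = - a" using ac by (simp add: eq_neg_iff_add_eq_0 add.commute)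
    ultimately have "a = 0" by simp
    then have "P w = 0" using D\<phi>a linear_0[OF lin\<phi>[OF U(2)]] by simp
    have "c = 0" using ac \<open>a = 0\<close> by simp
    then have "D\<phi> p (D\<psi> u0 n) \<bullet> n = 0" using c[of "D\<psi> u0 n"] by simp
    then have "n = 0" using d2[OF U(2)] by (simp add: u0_def)
    then show ?thesis using \<open>P w = 0\<close> by (simp add: n_def)
  qed
  then have "inj E'" using has_derivative_linear[OF dE] by (simp add: linear_injective_0)
  then have inj: "inj (frechet_derivative E (at u0))" using frechet_derivative_at[OF dE] by simp
  have Eu0: "E u0 = p" using u0 by (simp add: E_def)
  obtain U0 V0 G where U0: "open U0" "u0 \<in> U0" "U0 \<subseteq> V1" and V0: "open V0" "E u0 \<in> V0" "smooth_on V0 G"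
    and G1: "\<And>x. x \<in> U0 \<Longrightarrow> E x \<in> V0 \<and> G (E x) = x" and G2: "\<And>y. y \<in> V0 \<Longrightarrow> G y \<in> U0 \<and> E (G y) = y"
    by (rule smooth_inverse_function[OF smE u0V1 inj]) (rule that)
  \<comment> \<open>The adjoint of \<open>D\<psi> (\<phi> y)\<close> applied to
    \<open>x - y\<close>. If \<open>y\<close> is nearest to \<open>x\<close>, this is orthogonal to
    \<open>L\<close>, and \<open>\<phi> y + N x y\<close> is the parameter that \<open>E\<close>
    maps to \<open>x\<close>.\<close>
  define N where "N = (\<lambda>x y. (\<Sum>b\<in>Basis. (D\<psi> (\<phi> y) b \<bullet> (x - y)) *\<^sub>R b))"
  have csnd: "continuous_on (UNIV \<times> U) (\<lambda>z :: 'a \<times> 'a. g (snd z))" if "smooth_on U g" for g :: "'a \<Rightarrow> 'a"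
    by (rule continuous_on_compose2[OF smooth_on_imp_continuous_on[OF that] continuous_on_snd[OF continuous_on_id]])
      auto
  have cD: "continuous_on (UNIV \<times> U) (\<lambda>z :: 'a \<times> 'a. D\<psi> (\<phi> (snd z)) b)" for b
  proof -
    have "smooth_on U (\<lambda>y. D\<psi> (\<phi> y) b)"
      unfolding D\<psi>_def by (rule smooth_on_compose[OF smooth_on_derivative[OF sm(2)] sm(1)]) (use c1 in blast)
    then show ?thesis by (rule csnd)
  qed
  have "continuous_on (UNIV \<times> U) (\<lambda>z. \<phi> (snd z) + N (fst z) (snd z))"
    unfolding N_def by (intro continuous_intros cD csnd[OF sm(1)])
  \<comment> \<open>\<open>G (E w) = w\<close> is known for \<open>w\<close> in \<open>U0\<close>.
    As \<open>(p, p)\<close> yields \<open>u0\<close>, continuity keeps the parameter in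
    \<open>U0\<close> for \<open>x\<close> and \<open>y\<close> close to \<open>p\<close>.\<close>
  then have "open ((UNIV \<times> U) \<inter> (\<lambda>z. \<phi> (snd z) + N (fst z) (snd z)) -` U0)"
    using U U0 by (intro continuous_open_preimage) (auto simp: open_Times)
  moreover have "(p, p) \<in> (UNIV \<times> U) \<inter> (\<lambda>z. \<phi> (snd z) + N (fst z) (snd z)) -` U0"
    using U U0 by (simp add: N_def u0_def)
  ultimately obtain A B where AB: "open A" "open B" "p \<in> A" "p \<in> B"
    "A \<times> B \<subseteq> (UNIV \<times> U) \<inter> (\<lambda>z. \<phi> (snd z) + N (fst z) (snd z)) -` U0"
    by (rule open_prod_elim) auto
  obtain e where e: "e > 0" "ball p e \<subseteq> B" using AB open_contains_ball by blast
  obtain R where R: "R > 0" "\<And>x. dist p x < R \<Longrightarrow> \<exists>y. is_nearest_point Z x y"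
    by (rule submanifold_nearest_point_exists[OF Z p]) (rule that)
  \<comment> \<open>A nearest point satisfies \<open>dist p y \<le> 2 * dist p x\<close>, so the
    radius \<open>e / 2\<close> for \<open>x\<close> forces \<open>y\<close> into
    \<open>ball p e\<close>.\<close>
  define W where "W = V0 \<inter> A \<inter> ball p R \<inter> ball p (e / 2)"
  have W: "open W" "p \<in> W" using V0 AB e R Eu0 by (auto simp: W_def)
  define r where "r = (\<lambda>x. \<psi> (P (G x)))"
  have uniq: "y = r x" if x: "x \<in> W" and y: "is_nearest_point Z x y" for x y
  proof -
    have "dist x y \<le> dist x p" using y p by (simp add: is_nearest_point_def)
    moreover have "dist p y \<le> dist p x + dist x y" by (rule dist_triangle)
    moreover have "dist p x < e / 2" using x by (simp add: W_def)
    ultimately have "dist p y < e" by (simp add: dist_commute)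
    then have "y \<in> B" using e by auto
    then have yU: "y \<in> U" and wU0: "\<phi> y + N x y \<in> U0" using x AB(5) by (auto simp: W_def)
    have yV: "\<phi> y \<in> V" "\<psi> (\<phi> y) = y" using c1 yU by auto
    have yL: "\<phi> y \<in> L" using mem[OF yU] y by (simp add: is_nearest_point_def)
    have n: "N x y \<bullet> v = D\<psi> (\<phi> y) v \<bullet> (x - y)" for v unfolding N_def by (rule adj[OF lin\<psi>[OF yV(1)]])
    have "N x y \<bullet> l = 0" if "l \<in> L" for l
    proof -
      have "D\<psi> (\<phi> y) l \<bullet> (x - \<psi> (\<phi> y)) = 0"
      proof (rule nearest_point_orthogonal[OF V yV(1) _ L yL that])
        show "(\<psi> has_derivative D\<psi> (\<phi> y)) (at (\<phi> y))"
          using smooth_on_has_derivative[OF sm(2) yV(1)] by (simp add: D\<psi>_def)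
        show "\<psi> w \<in> Z" if "w \<in> V" "w \<in> L" for w using mem[of "\<psi> w"] c2[OF that(1)] that by simp
        show "is_nearest_point Z x (\<psi> (\<phi> y))" using y yV by simp
      qed
      then show ?thesis using n yV by simp
    qed
    then have "P (N x y) = 0" by (intro P(5) ballI)
    then have Pw: "P (\<phi> y + N x y) = \<phi> y" using P(1,4) yL by (simp add: linear_add)
    have "D\<phi> y b \<bullet> N x y = b \<bullet> (x - y)" for b
      using n[of "D\<phi> y b"] d1[OF yU] by (simp add: inner_commute)
    then have "E (\<phi> y + N x y) = y + (\<Sum>b\<in>Basis. (b \<bullet> (x - y)) *\<^sub>R b)"
      by (simp add: E_def Pw yV)
    also have "\<dots> = x" using euclidean_representation[of "x - y"] by (simp add: inner_commute)
    finally have "G x = \<phi> y + N x y" using G1[OF wU0] by simp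
    then show "y = r x" by (simp add: r_def Pw yV)
  qed
  show thesis
  proof (rule that[of W r])
    have sG: "smooth_on W G" by (rule smooth_on_subset[OF V0(3) W(1)]) (auto simp: W_def)
    show "smooth_on W r"
      unfolding r_def
    proof (rule smooth_on_compose[OF sm(2) smooth_on_linear_compose[OF blP sG]])
      fix x assume "x \<in> W"
      then have "G x \<in> V1" using G2 U0 by (auto simp: W_def)
      then show "P (G x) \<in> V" by (simp add: V1_def)
    qed
    show "is_nearest_point Z x (r x)" if "x \<in> W" for x
      using R(2)[of x] uniq[OF that] that by (auto simp: W_def)
  qed (use W uniq in auto)
qed

text \<open>A unique nearest point does not depend on the local construction, so the local
  projections agree on overlaps and glue to one smooth map on the union of their domains.\<close>

lemma submanifold_smooth_retraction:
  fixes Z :: "'a::euclidean_space set"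
  assumes Z: "submanifold Z"
  obtains T \<pi> where "Z \<subseteq> T" "smooth_on T \<pi>" "\<And>x. x \<in> T \<Longrightarrow> \<pi> x \<in> Z" "\<And>z. z \<in> Z \<Longrightarrow> \<pi> z = z"
proof -
  define ok where "ok = (\<lambda>W r. smooth_on W r \<and> (\<forall>x\<in>W. is_nearest_point Z x (r x)
    \<and> (\<forall>y. is_nearest_point Z x y \<longrightarrow> y = r x)))"
  define \<pi> where "\<pi> = (\<lambda>x. THE y. is_nearest_point Z x y)"
  define T where "T = \<Union>{W. \<exists>r. ok W r}"
  have eq: "\<pi> x = r x" if "ok W r" "x \<in> W" for W r x
    unfolding \<pi>_def using that by (intro the_equality) (auto simp: ok_def)
  have ZT: "Z \<subseteq> T"
  proof
    fix p assume "p \<in> Z"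
    obtain W r where "p \<in> W" "smooth_on W r" "\<And>x. x \<in> W \<Longrightarrow> is_nearest_point Z x (r x)"
      "\<And>x y. x \<in> W \<Longrightarrow> is_nearest_point Z x y \<Longrightarrow> y = r x"
      by (rule submanifold_nearest_point_smooth[OF Z \<open>p \<in> Z\<close>]) (rule that)
    then have "ok W r" "p \<in> W" by (auto simp: ok_def)
    then show "p \<in> T" by (auto simp: T_def)
  qed
  have near: "is_nearest_point Z x (\<pi> x)" if "x \<in> T" for x
    using that eq unfolding T_def ok_def by auto
  show thesis
  proof (rule that[of T \<pi>])
    show "smooth_on T \<pi>"
    proof (rule smooth_on_Union)
      fix x assume "x \<in> T"
      then obtain W r where W: "ok W r" "x \<in> W" by (auto simp: T_def)
      have "smooth_on W \<pi>"
        by (rule smooth_on_cong[of W r]) (use W eq in \<open>auto simp: ok_def\<close>)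
      then show "\<exists>U. x \<in> U \<and> U \<subseteq> T \<and> smooth_on U \<pi>" using W by (auto simp: T_def)
    qed
    show "\<pi> x \<in> Z" if "x \<in> T" for x using near[OF that] by (simp add: is_nearest_point_def)
    show "\<pi> z = z" if "z \<in> Z" for z
    proof -
      have "dist z (\<pi> z) \<le> dist z z"
        using near[of z] ZT that unfolding is_nearest_point_def by blast
      then show ?thesis by simp
    qed
  qed (rule ZT)
qed

text \<open>The constant Euclidean metric serves as Riemannian metric, so constructing tubes amounts
  to constructing retractions.\<close>

lemma tube_of_retraction:
  assumes "Z \<subseteq> T" "smooth_on T \<pi>" "\<And>x. x \<in> T \<Longrightarrow> \<pi> x \<in> Z" "\<And>z. z \<in> Z \<Longrightarrow> \<pi> z = z"
  shows "tube Z T \<pi> (\<lambda>x. (x - \<pi> x) \<bullet> (x - \<pi> x))"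
proof -
  have "open T" using assms(2) by (simp add: smooth_on_def)
  then have "riemannian_metric T (\<lambda>p u v. u \<bullet> v)"
    by (auto simp: riemannian_metric_def inner_commute smooth_on_const
        bilinear_conv_bounded_bilinear bounded_bilinear_inner)
  then show ?thesis
    using assms \<open>open T\<close> unfolding tube_def by blast
qed

section \<open>Bump functions and extension of local retractions\<close>

text \<open>For \<open>n = 0\<close> this is the usual function that is flat at the origin; the
  factor \<open>inverse t ^ n\<close> makes derivatives linear combinations of members of the
  family.\<close>

definition exp_bump :: "nat \<Rightarrow> real \<Rightarrow> real" where
  "exp_bump n t = (if t \<le> 0 then 0 else inverse t ^ n * exp (- inverse t))"

lemma exp_bump_has_derivative:
  "(exp_bump n has_real_derivative exp_bump (n + 2) t - real n * exp_bump (n + 1) t) (at t)"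
proof (cases t "0 :: real" rule: linorder_cases)
  case less
  have "((\<lambda>t. 0) has_real_derivative 0) (at t)" by simp
  then have "(exp_bump n has_real_derivative 0) (at t)"
    by (rule has_field_derivative_transform_within_open[where S="{..<0}"]) (use less in \<open>auto simp: exp_bump_def\<close>)
  then show ?thesis using less by (simp add: exp_bump_def)
next
  case greater
  have i: "(inverse has_real_derivative - (inverse t ^ 2)) (at t)"
    using DERIV_inverse[of t UNIV] greater by (simp add: power2_eq_square)
  have e: "((\<lambda>t. exp (- inverse t)) has_real_derivative exp (- inverse t) * inverse t ^ 2) (at t)"
    using DERIV_chain'[OF DERIV_minus[OF i] DERIV_exp] by simp
  have "((\<lambda>t. inverse t ^ n * exp (- inverse t)) has_real_derivative
      inverse t ^ n * (exp (- inverse t) * inverse t ^ 2)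
      + (real n * (- (inverse t ^ 2) * inverse t ^ (n - Suc 0))) * exp (- inverse t)) (at t)"
    using DERIV_mult'[OF DERIV_power[OF i] e] .
  also have "inverse t ^ n * (exp (- inverse t) * inverse t ^ 2)
      + (real n * (- (inverse t ^ 2) * inverse t ^ (n - Suc 0))) * exp (- inverse t)
      = exp_bump (n + 2) t - real n * exp_bump (n + 1) t"
    \<comment> \<open>For \<open>n = 0\<close> the exponent \<open>n - Suc 0\<close> is truncated,
      harmlessly because of the factor \<open>real n\<close>.\<close>
    using greater by (cases n) (simp_all add: exp_bump_def power2_eq_square algebra_simps)
  finally have "((\<lambda>t. inverse t ^ n * exp (- inverse t)) has_real_derivative
      exp_bump (n + 2) t - real n * exp_bump (n + 1) t) (at t)" .
  then show ?thesis
    by (rule has_field_derivative_transform_within_open[where S="{0<..}"]) (use greater in \<open>auto simp: exp_bump_def\<close>)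
next
  case equal
  have "((\<lambda>h. exp_bump n h / h) \<longlongrightarrow> 0) (at_left 0)"
  proof (rule tendsto_eventually)
    show "\<forall>\<^sub>F h in at_left 0. exp_bump n h / h = 0"
      by (auto simp: eventually_at_left_field exp_bump_def intro: exI[of _ "-1"])
  qed
  moreover have "((\<lambda>h. exp_bump n h / h) \<longlongrightarrow> 0) (at_right 0)"
  proof -
    \<comment> \<open>The extra power of \<open>inverse h\<close> comes from dividing by
      \<open>h\<close>.\<close>
    have "((\<lambda>h::real. inverse h ^ (n + 1) / exp (inverse h)) \<longlongrightarrow> 0) (at_right 0)"
      by (rule filterlim_compose[OF tendsto_power_div_exp_0 filterlim_inverse_at_top_right])
    moreover have "\<forall>\<^sub>F h in at_right (0::real). inverse h ^ (n + 1) / exp (inverse h) = exp_bump n h / h"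
      unfolding eventually_at_right_field
      by (rule exI[of _ 1]) (auto simp: exp_bump_def exp_minus field_simps)
    ultimately show ?thesis by (rule Lim_transform_eventually)
  qed
  ultimately have "((\<lambda>h. exp_bump n h / h) \<longlongrightarrow> 0) (at 0)"
    by (simp add: filterlim_at_split)
  then show ?thesis using equal by (simp add: has_field_derivative_iff exp_bump_def)
qed

lemma smooth_exp_bump: "smooth_on UNIV (exp_bump n)"
proof -
  have "k_smooth_on k UNIV (exp_bump n)" for k n
  proof (induction k arbitrary: n)
    case (Suc k)
    show ?case
    proof (rule k_smooth_on_SucI[OF open_UNIV])
      show "(exp_bump n has_derivative (\<lambda>v. v *\<^sub>R (exp_bump (n + 2) t + (- real n) *\<^sub>R exp_bump (n + 1) t))) (at t)" for t
        using exp_bump_has_derivative[of n t] by (simp add: has_field_derivative_def mult_commute_abs)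
      show "k_smooth_on k UNIV (\<lambda>t. v *\<^sub>R (exp_bump (n + 2) t + (- real n) *\<^sub>R exp_bump (n + 1) t))" for v
        by (intro k_smooth_on_bilinear[OF bounded_bilinear_scaleR] k_smooth_on_add k_smooth_on_const
            open_UNIV Suc.IH)
    qed
  qed auto
  then show ?thesis by (simp add: smooth_on_iff_k_smooth_on)
qed

text \<open>Multiplication by \<open>f x\<close> is an invertible linear map of the line, so this is
  a case of the result on families of linear maps.\<close>

lemma smooth_on_inverse:
  fixes f :: "'a::euclidean_space \<Rightarrow> real"
  assumes f: "smooth_on S f" and nz: "\<And>x. x \<in> S \<Longrightarrow> f x \<noteq> 0"
  shows "smooth_on S (\<lambda>x. inverse (f x))"
proof -
  have op: "open S" using f by (simp add: smooth_on_def)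
  have bij: "bij (\<lambda>w. f x * w)" if "x \<in> S" for x
    using nz[OF that] by (intro bij_betw_byWitness[where f' = "\<lambda>w. w / f x"]) auto
  have "k_smooth_on k S (\<lambda>x. inv (\<lambda>w. f x * w) 1)" for k
  proof (rule k_smooth_on_linear_family_inverse[OF op _ bij])
    show "k_smooth_on k S (\<lambda>x. f x * w)" for w
      using f op by (intro k_smooth_on_bilinear[OF bounded_bilinear_mult] k_smooth_on_const)
        (auto simp: smooth_on_iff_k_smooth_on)
  qed (auto intro: bounded_linear.linear bounded_linear_mult_right)
  then have "smooth_on S (\<lambda>x. inv (\<lambda>w. f x * w) 1)" using op by (simp add: smooth_on_iff_k_smooth_on)
  then show ?thesis
  proof (rule smooth_on_cong)
    fix x assume x: "x \<in> S"
    show "inv (\<lambda>w. f x * w) 1 = inverse (f x)"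
      by (rule inv_f_eq) (use bij[OF x] nz[OF x] in \<open>auto simp: bij_is_inj\<close>)
  qed
qed

lemma smooth_bump_exists:
  fixes p :: "'a::euclidean_space"
  assumes "open W" "p \<in> W"
  obtains \<eta> :: "'a \<Rightarrow> real" and B C where "smooth_on UNIV \<eta>" "open B" "p \<in> B" "B \<subseteq> W"
    "\<And>x. x \<in> B \<Longrightarrow> \<eta> x = 1" "closed C" "C \<subseteq> W" "\<And>x. x \<notin> C \<Longrightarrow> \<eta> x = 0"
proof -
  obtain b where b: "b > 0" "cball p b \<subseteq> W" using assms open_contains_cball by blast
  define d where "d = (\<lambda>x. (x - p) \<bullet> (x - p))"
  have d: "d x = (dist p x)\<^sup>2" for x unfolding d_def by (metis dist_norm dist_commute power2_norm_eq_inner)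
  define e where "e = exp_bump 0"
  have e: "e t > 0 \<longleftrightarrow> t > 0" "e t \<ge> 0" "t \<le> 0 \<Longrightarrow> e t = 0" for t by (auto simp: e_def exp_bump_def)
  have smd: "smooth_on UNIV d"
    unfolding d_def by (intro smooth_on_inner smooth_on_diff smooth_on_id smooth_on_const open_UNIV)
  have sme: "smooth_on UNIV (\<lambda>x. e (h x))" if "smooth_on UNIV h" for h :: "'a \<Rightarrow> real"
    unfolding e_def by (rule smooth_on_compose[OF smooth_exp_bump that]) simp
  \<comment> \<open>The first summand is positive iff \<open>d x < b^2\<close>, the second iff
    \<open>d x > (b/2)^2\<close>, and one of these always holds. Dividing the first by
    \<open>s\<close> gives 1 where the second vanishes and 0 where the first does.\<close>
  define s where "s = (\<lambda>x. e (b\<^sup>2 - d x) + e (d x - (b/2)\<^sup>2))"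
  have b2: "(b/2)\<^sup>2 < b\<^sup>2" using b by (simp add: power_divide)
  have pos: "s x > 0" for x
  proof (cases "d x < b\<^sup>2")
    case True
    then have "e (b\<^sup>2 - d x) > 0" using e(1) by simp
    then show ?thesis unfolding s_def using e(2) by (rule add_pos_nonneg)
  next
    case False
    then have "e (d x - (b/2)\<^sup>2) > 0" using e(1) b2 by simp
    then show ?thesis unfolding s_def using e(2) by (intro add_nonneg_pos)
  qed
  have nz: "s x \<noteq> 0" for x using pos[of x] by simp
  define \<eta> where "\<eta> = (\<lambda>x. e (b\<^sup>2 - d x) *\<^sub>R inverse (s x))"
  show thesis
  proof (rule that[of \<eta> "ball p (b/2)" "cball p b"])
    have "smooth_on UNIV s"
      unfolding s_def by (intro smooth_on_add sme smooth_on_diff smooth_on_const smd open_UNIV)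
    then show "smooth_on UNIV \<eta>"
      unfolding \<eta>_def
      by (intro smooth_on_scaleR sme smooth_on_diff smooth_on_const smd open_UNIV smooth_on_inverse nz)
    show "\<eta> x = 1" if "x \<in> ball p (b/2)" for x
    proof -
      have "d x \<le> (b/2)\<^sup>2" unfolding d by (rule power_mono) (use that in auto)
      then have "s x = e (b\<^sup>2 - d x)" using e(3) by (simp add: s_def)
      then show ?thesis using nz[of x] by (simp add: \<eta>_def)
    qed
    show "\<eta> x = 0" if "x \<notin> cball p b" for x
    proof -
      have "b\<^sup>2 \<le> d x" unfolding d by (rule power_mono) (use that b in auto)
      then show ?thesis using e(3) by (simp add: \<eta>_def)
    qed
    show "ball p (b/2) \<subseteq> W" using b by force
  qed (use b in auto)
qed

text \<open>With a global retraction \<open>\<pi>0\<close> at hand, \<open>\<pi>0 \<circ> (\<eta> r + (1 - \<eta>) \<pi>0)\<close> is a retraction near \<open>Z\<close> that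
  agrees with \<open>r\<close> where \<open>\<eta> = 1\<close>.\<close>

lemma tube_extending_local_retraction:
  fixes Z :: "'a::euclidean_space set"
  assumes Z: "submanifold Z" and p: "p \<in> W" "p \<in> Z" and r: "smooth_on W r"
    and rZ: "\<And>x. x \<in> W \<Longrightarrow> r x \<in> Z" and rid: "\<And>x. x \<in> W \<Longrightarrow> x \<in> Z \<Longrightarrow> r x = x"
  obtains T \<pi> \<rho> W0 where "tube Z T \<pi> \<rho>" "open W0" "p \<in> W0" "W0 \<subseteq> W" "W0 \<subseteq> T"
    "\<And>x. x \<in> W0 \<Longrightarrow> \<pi> x = r x"
proof -
  have oW: "open W" using r by (simp add: smooth_on_def)
  obtain T0 \<pi>0 where T0: "Z \<subseteq> T0" "smooth_on T0 \<pi>0" "\<And>x. x \<in> T0 \<Longrightarrow> \<pi>0 x \<in> Z" "\<And>z. z \<in> Z \<Longrightarrow> \<pi>0 z = z"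
    by (rule submanifold_smooth_retraction[OF Z]) (rule that)
  have oT0: "open T0" using T0 by (simp add: smooth_on_def)
  obtain \<eta> :: "'a \<Rightarrow> real" and B C where \<eta>: "smooth_on UNIV \<eta>" and B: "open B" "p \<in> B" "B \<subseteq> W"
    "\<And>x. x \<in> B \<Longrightarrow> \<eta> x = 1" and C: "closed C" "C \<subseteq> W" "\<And>x. x \<notin> C \<Longrightarrow> \<eta> x = 0"
    by (rule smooth_bump_exists[OF oW p(1)]) (rule that)
  \<comment> \<open>An average of points of \<open>Z\<close> need not lie in \<open>Z\<close>, which
    is why \<open>\<pi>0\<close> is applied once more afterwards.\<close>
  define q where "q = (\<lambda>x. if x \<in> W then \<eta> x *\<^sub>R r x + (1 - \<eta> x) *\<^sub>R \<pi>0 x else \<pi>0 x)"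
  have q1: "smooth_on (T0 \<inter> W) q"
  proof (rule smooth_on_cong)
    have o: "open (T0 \<inter> W)" using oT0 oW by blast
    show "smooth_on (T0 \<inter> W) (\<lambda>x. \<eta> x *\<^sub>R r x + (1 - \<eta> x) *\<^sub>R \<pi>0 x)"
      using o by (intro smooth_on_add smooth_on_scaleR smooth_on_diff smooth_on_const
          smooth_on_subset[OF r o] smooth_on_subset[OF T0(2) o] smooth_on_subset[OF \<eta> o]) auto
  qed (simp add: q_def)
  have q2: "smooth_on (T0 - C) q"
  proof (rule smooth_on_cong)
    show "smooth_on (T0 - C) \<pi>0" using oT0 C by (intro smooth_on_subset[OF T0(2)]) auto
  qed (use C in \<open>simp add: q_def\<close>)
  \<comment> \<open>The open sets \<open>T0 \<inter> W\<close> and \<open>T0 - C\<close> cover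
    \<open>T0\<close> because \<open>C \<subseteq> W\<close>; a support closed inside
    \<open>W\<close> makes the case distinction in \<open>q\<close> smooth.\<close>
  have q: "smooth_on T0 q"
  proof (rule smooth_on_Union)
    fix x assume "x \<in> T0"
    then show "\<exists>U. x \<in> U \<and> U \<subseteq> T0 \<and> smooth_on U q" using q1 q2 C(2) by (cases "x \<in> C") blast+
  qed
  have qZ: "q z = z" if "z \<in> Z" for z
    using that T0(4) rid by (simp add: q_def algebra_simps flip: scaleR_add_left)
  \<comment> \<open>The average may even leave \<open>T0\<close>; such points are removed. Points of
    \<open>Z\<close> remain, since \<open>q\<close> fixes them.\<close>
  define T where "T = {x \<in> T0. q x \<in> T0}"
  have T: "open T" unfolding T_def by (rule open_preimage_smooth_on[OF q oT0])
  define \<pi> where "\<pi> = (\<lambda>x. \<pi>0 (q x))"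
  have "tube Z T \<pi> (\<lambda>x. (x - \<pi> x) \<bullet> (x - \<pi> x))"
  proof (rule tube_of_retraction)
    show "Z \<subseteq> T" using T0(1) qZ by (auto simp: T_def)
    show "smooth_on T \<pi>"
      unfolding \<pi>_def by (rule smooth_on_compose[OF T0(2) smooth_on_subset[OF q T]]) (auto simp: T_def)
  qed (use T0 qZ in \<open>auto simp: \<pi>_def T_def\<close>)
  moreover have qB: "q x = r x" "r x \<in> Z" if "x \<in> B" for x using that B(3,4) rZ by (auto simp: q_def)
  then have "\<pi> x = r x" if "x \<in> B \<inter> T0" for x using that T0(4) by (simp add: \<pi>_def)
  moreover have "B \<inter> T0 \<subseteq> T" using qB T0(1) by (auto simp: T_def)
  ultimately show thesis
    using that[of T \<pi> _ "B \<inter> T0"] B oT0 p(2) T0(1) by blast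
qed

section \<open>Transformations\<close>

lemma strat_iso_smooth_embedding:
  assumes "smooth_embedding T" "T ` A = B" "\<And>X. X \<in> AA \<Longrightarrow> T ` X \<in> BB"
  shows "strat_iso T A AA B BB"
  unfolding strat_iso_def
  using homeomorphism_smooth_embedding[OF assms(1), of A] diffeo_betw_smooth_embedding[OF assms(1)] assms(2,3)
  by blast

text \<open>Formulated for arbitrary \<open>Y\<close> and \<open>Y'\<close> so that it serves both
  \<open>F\<close> with \<open>F'\<close> and each pair of corresponding strata.\<close>

lemma transformation_image_vimage:
  assumes comm: "f' \<circ> Tvar = Ttar \<circ> f" and inj: "inj Ttar" and f'M: "range f' \<subseteq> M"
    and f'N: "f' -` range Ttar \<subseteq> range Tvar" and Y: "Ttar ` Y = Y' \<inter> M"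
  shows "Tvar ` (f -` Y) = f' -` Y'"
proof
  have eq: "f' (Tvar x) = Ttar (f x)" for x using fun_cong[OF comm, of x] by simp
  show "Tvar ` (f -` Y) \<subseteq> f' -` Y'" using Y eq by auto
  show "f' -` Y' \<subseteq> Tvar ` (f -` Y)"
  proof
    fix y assume "y \<in> f' -` Y'"
    then have "f' y \<in> Ttar ` Y" using Y f'M by auto
    moreover from this obtain x where "y = Tvar x" using f'N by blast
    ultimately show "y \<in> Tvar ` (f -` Y)" using eq inj by (auto simp: inj_image_mem_iff)
  qed
qed

text \<open>The retraction \<open>r\<close> onto \<open>Z'\<close> preserves \<open>M\<close> near \<open>T z\<close>, hence maps \<open>range T\<close> into \<open>Z' \<inter> M = T ` Z\<close>
  and pulls back along \<open>T\<close> to a retraction onto \<open>Z\<close>. As the fiber of \<open>r\<close> over \<open>T z\<close> lies in \<open>M\<close>, the two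
  fibers correspond.\<close>

lemma corresponding_tubes_exist:
  fixes T :: "'b::euclidean_space \<Rightarrow> 'c::euclidean_space"
  assumes M: "submanifold M" and T: "smooth_embedding T" and TM: "range T \<subseteq> M"
    and Z: "submanifold Z" "z \<in> Z" and Z': "submanifold Z'" and TZ: "T ` Z = Z' \<inter> M"
    and trans: "inclusion_transversal M Z'"
  obtains S \<pi> \<rho> S' \<pi>' \<rho>' U U' where "tube Z S \<pi> \<rho>" "tube Z' S' \<pi>' \<rho>'"
    "open U" "z \<in> U" "U \<subseteq> S" "open U'" "T z \<in> U'" "U' \<subseteq> S'"
    "\<And>Y Y'. T ` Y = Y' \<inter> M \<Longrightarrow> T ` (Y \<inter> \<pi> -` {z} \<inter> U) = Y' \<inter> \<pi>' -` {T z} \<inter> U'"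
proof -
  have inj: "T x = T y \<longleftrightarrow> x = y" for x y using T by (auto simp: smooth_embedding_def inj_def)
  have smT: "smooth_on UNIV T" using T by (simp add: smooth_embedding_def smooth_def)
  have z: "T z \<in> M" "T z \<in> Z'" using TZ Z(2) by auto
  have tr: "set_sum (tangent_space M (T z)) (tangent_space Z' (T z)) = UNIV"
    using trans z by (simp add: inclusion_transversal_def)
  obtain W r where W: "open W" "T z \<in> W" "smooth_on W r"
    and rZ: "\<And>x. x \<in> W \<Longrightarrow> r x \<in> Z'" and rid: "\<And>x. x \<in> W \<Longrightarrow> x \<in> Z' \<Longrightarrow> r x = x"
    and rM: "\<And>x. x \<in> W \<Longrightarrow> x \<in> M \<Longrightarrow> r x \<in> M" and rfib: "\<And>x. x \<in> W \<Longrightarrow> r x = T z \<Longrightarrow> x \<in> M"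
    by (rule transversal_local_retraction[OF M z(1) Z' z(2) tr]) (rule that)
  obtain S' \<pi>' \<rho>' W' where S': "tube Z' S' \<pi>' \<rho>'" and W': "open W'" "T z \<in> W'" "W' \<subseteq> W" "W' \<subseteq> S'"
    and \<pi>': "\<And>x. x \<in> W' \<Longrightarrow> \<pi>' x = r x"
    by (rule tube_extending_local_retraction[OF Z' W(2) z(2) W(3) rZ rid]) (assumption | rule that)+
  obtain H h where H: "open H" "T z \<in> H" "smooth_on H h" and h: "\<And>x. T x \<in> H \<Longrightarrow> h (T x) = x"
    by (rule smooth_embedding_local_left_inverse[OF T]) (rule that)
  define s where "s = (\<lambda>x. h (r (T x)))"
  \<comment> \<open>On \<open>Q\<close> the point \<open>r (T x)\<close> stays where
    \<open>h\<close> undoes \<open>T\<close>; \<open>z\<close> belongs to it because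
    \<open>r\<close> fixes \<open>T z\<close>.\<close>
  define Q where "Q = {x \<in> UNIV. T x \<in> {y \<in> W'. r y \<in> H}}"
  have smr: "smooth_on W' r" by (rule smooth_on_subset[OF W(3) W'(1,3)])
  have Q: "open Q"
    unfolding Q_def by (rule open_preimage_smooth_on[OF smT open_preimage_smooth_on[OF smr H(1)]])
  have zQ: "z \<in> Q" using W W' H rid[OF W(2) z(2)] by (simp add: Q_def)
  have sms: "smooth_on Q s"
    unfolding s_def
  proof (rule smooth_on_compose[OF H(3)])
    show "smooth_on Q (\<lambda>x. r (T x))"
      by (rule smooth_on_compose[OF smr smooth_on_subset[OF smT Q]]) (auto simp: Q_def)
  qed (simp add: Q_def)
  have sZ: "s x \<in> Z \<and> T (s x) = r (T x)" if "x \<in> Q" for x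
  proof -
    have xW: "T x \<in> W" "r (T x) \<in> H" using that W'(3) by (auto simp: Q_def)
    moreover have "T x \<in> M" using TM by blast
    ultimately have "r (T x) \<in> T ` Z" using TZ rZ rM by simp
    then obtain y where y: "y \<in> Z" "r (T x) = T y" by blast
    then have "s x = y" using h[of y] xW(2) by (simp add: s_def)
    then show ?thesis using y by simp
  qed
  have sid: "s x = x" if "x \<in> Q" "x \<in> Z" for x
  proof -
    have "T x \<in> Z'" "T x \<in> W" using TZ that W'(3) by (auto simp: Q_def)
    then have "T (s x) = T x" using sZ[OF that(1)] rid by simp
    then show ?thesis by (simp add: inj)
  qed
  have sZ1: "s x \<in> Z" if "x \<in> Q" for x using sZ[OF that] by blast
  obtain S \<pi> \<rho> U where S: "tube Z S \<pi> \<rho>" and U: "open U" "z \<in> U" "U \<subseteq> Q" "U \<subseteq> S"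
    and \<pi>: "\<And>x. x \<in> U \<Longrightarrow> \<pi> x = s x"
    by (rule tube_extending_local_retraction[OF Z(1) zQ Z(2) sms sZ1 sid]) (assumption | rule that)+
  obtain X where X: "open X" "T -` X = U"
    by (rule smooth_embedding_vimage_open[OF T U(1)]) (rule that)
  \<comment> \<open>Intersecting with \<open>X\<close> ensures that a point \<open>T x\<close> of
    \<open>U'\<close> has \<open>x\<close> in \<open>U\<close>, where \<open>\<pi>\<close> is given
    by \<open>s\<close>.\<close>
  define U' where "U' = W' \<inter> X"
  have TU: "T x \<in> U' \<longleftrightarrow> x \<in> U" for x using X(2) U(3) by (auto simp: U'_def Q_def)
  have fib: "\<pi> x = z \<longleftrightarrow> \<pi>' (T x) = T z" if "x \<in> U" for x
  proof -
    have "x \<in> Q" "T x \<in> W'" using that U(3) by (auto simp: Q_def)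
    then have "\<pi>' (T x) = T (\<pi> x)" using \<pi>[OF that] \<pi>' sZ by simp
    then show ?thesis by (simp add: inj)
  qed
  have img: "T ` (Y \<inter> \<pi> -` {z} \<inter> U) = Y' \<inter> \<pi>' -` {T z} \<inter> U'" if Y: "T ` Y = Y' \<inter> M" for Y Y'
  proof (intro equalityI subsetI)
    fix y assume "y \<in> T ` (Y \<inter> \<pi> -` {z} \<inter> U)"
    then show "y \<in> Y' \<inter> \<pi>' -` {T z} \<inter> U'" using Y TU fib by auto
  next
    fix y assume y: "y \<in> Y' \<inter> \<pi>' -` {T z} \<inter> U'"
    then have "y \<in> W'" "\<pi>' y = T z" by (auto simp: U'_def)
    then have "y \<in> M" using rfib \<pi>' W'(3) by auto
    then obtain x where x: "x \<in> Y" "y = T x" using Y y by blast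
    then have "x \<in> U" using TU y by blast
    then show "y \<in> T ` (Y \<inter> \<pi> -` {z} \<inter> U)" using x fib \<open>\<pi>' y = T z\<close> by auto
  qed
  have "open U'" "T z \<in> U'" "U' \<subseteq> S'" using X(1) W' TU[of z] U(2) by (auto simp: U'_def)
  from S S' U(1,2,4) this img show thesis by (rule that)
qed

theorem theorem5:
  fixes F :: "'b::euclidean_space set" and FF :: "'b set set"
    and f :: "'a::euclidean_space \<Rightarrow> 'b"
    and M :: "'c::euclidean_space set" and Ttar :: "'b \<Rightarrow> 'c"
    and F' :: "'c set" and FF' :: "'c set set"
    and Tvar :: "'a \<Rightarrow> 'd::euclidean_space" and f' :: "'d \<Rightarrow> 'c"
  assumes "locally_closed F"
    and "whitney_strat F FF"
    and "smooth f"
    and "\<forall>Z\<in>FF. transversal f Z"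
    and "regular_transformation F f M Ttar F' Tvar f'"
    and "regular_for FF M Ttar F' f' FF'"
  shows "strat_iso Tvar (f -` F) (preimage_strata f FF) (f' -` F') (preimage_strata f' FF')
     \<and> (\<forall>x\<in>f -` F. f' (Tvar x) = Ttar (f x))
     \<and> (\<forall>Z\<in>FF. f ` (f -` Z) \<subseteq> Z)
     \<and> (\<forall>Z'\<in>FF'. f' ` (f' -` Z') \<subseteq> Z')
     \<and> (\<forall>Z\<in>FF. \<exists>Z'\<in>FF'. Ttar ` Z = Z' \<inter> M \<and> Tvar ` (f -` Z) = f' -` Z')
     \<and> (\<forall>Z\<in>FF. \<forall>z\<in>Z. \<forall>Z'\<in>FF'. Ttar z \<in> Z' \<longrightarrow>
          (\<exists>T \<pi> \<rho> T' \<pi>' \<rho>' U U'.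
             tube Z T \<pi> \<rho> \<and> tube Z' T' \<pi>' \<rho>' \<and>
             open U \<and> z \<in> U \<and> U \<subseteq> T \<and> open U' \<and> Ttar z \<in> U' \<and> U' \<subseteq> T' \<and>
             strat_iso Ttar (fiber_set F \<pi> z U) (fiber_strata FF \<pi> z U)
                            (fiber_set F' \<pi>' (Ttar z) U') (fiber_strata FF' \<pi>' (Ttar z) U')))"
proof -
  have tr: "transformation F f M Ttar F' Tvar f'"
    using assms(5) by (simp add: regular_transformation_def)
  then have M: "submanifold M" and Ttar: "smooth_embedding Ttar" and TM: "range Ttar \<subseteq> M"
    and Tvar: "smooth_embedding Tvar" and FM: "Ttar ` F = F' \<inter> M"
    and comm: "f' \<circ> Tvar = Ttar \<circ> f" and f'M: "range f' \<subseteq> M" and f'N: "f' -` range Ttar \<subseteq> range Tvar"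
    by (auto simp: transformation_def)
  have inj: "inj Ttar" using Ttar by (simp add: smooth_embedding_def)
  have str: "(\<lambda>Z. Ttar ` Z) ` FF = {Z' \<inter> M | Z'. Z' \<in> FF' \<and> Z' \<inter> M \<noteq> {}}"
    and incl: "\<And>Z'. Z' \<in> FF' \<Longrightarrow> inclusion_transversal M Z'" and wF': "whitney_strat F' FF'"
    using assms(6) by (auto simp: regular_for_def)
  note vim = transformation_image_vimage[OF comm inj f'M f'N]
  have ex: "\<exists>Z'\<in>FF'. Ttar ` Z = Z' \<inter> M" if "Z \<in> FF" for Z
  proof -
    have "Ttar ` Z \<in> (\<lambda>Z. Ttar ` Z) ` FF" using that by (rule imageI)
    then show ?thesis unfolding str by blast
  qed
  have iso: "strat_iso Tvar (f -` F) (preimage_strata f FF) (f' -` F') (preimage_strata f' FF')"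
  proof (rule strat_iso_smooth_embedding[OF Tvar vim[OF FM]])
    fix X assume "X \<in> preimage_strata f FF"
    then obtain Z where Z: "X = f -` Z" "Z \<in> FF" "X \<noteq> {}" by (auto simp: preimage_strata_def)
    obtain Z' where Z': "Z' \<in> FF'" "Ttar ` Z = Z' \<inter> M" using ex[OF Z(2)] by blast
    have "Tvar ` X = f' -` Z'" using vim[OF Z'(2)] Z(1) by simp
    then show "Tvar ` X \<in> preimage_strata f' FF'" using Z(3) Z'(1) by (auto simp: preimage_strata_def)
  qed
  have eq: "f' (Tvar x) = Ttar (f x)" for x using fun_cong[OF comm, of x] by simp
  have strata: "\<exists>Z'\<in>FF'. Ttar ` Z = Z' \<inter> M \<and> Tvar ` (f -` Z) = f' -` Z'" if "Z \<in> FF" for Z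
  proof -
    obtain Z' where "Z' \<in> FF'" "Ttar ` Z = Z' \<inter> M" using ex[OF \<open>Z \<in> FF\<close>] by blast
    then show ?thesis using vim[OF \<open>Ttar ` Z = Z' \<inter> M\<close>] by (intro bexI[of _ Z'] conjI)
  qed
  have fibers: "\<exists>T \<pi> \<rho> T' \<pi>' \<rho>' U U'.
             tube Z T \<pi> \<rho> \<and> tube Z' T' \<pi>' \<rho>' \<and>
             open U \<and> z \<in> U \<and> U \<subseteq> T \<and> open U' \<and> Ttar z \<in> U' \<and> U' \<subseteq> T' \<and>
             strat_iso Ttar (fiber_set F \<pi> z U) (fiber_strata FF \<pi> z U)
                            (fiber_set F' \<pi>' (Ttar z) U') (fiber_strata FF' \<pi>' (Ttar z) U')"
    if ZZ: "Z \<in> FF" "z \<in> Z" "Z' \<in> FF'" "Ttar z \<in> Z'" for Z z Z'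
  proof -
    \<comment> \<open>\<open>Z'\<close> is given as any stratum through \<open>Ttar z\<close>;
      disjointness of \<open>FF'\<close> identifies it with the one that regularity attaches to
      \<open>Z\<close>.\<close>
    have TZ: "Ttar ` Z = Z' \<inter> M"
    proof -
      obtain Z'' where Z'': "Z'' \<in> FF'" "Ttar ` Z = Z'' \<inter> M" using ex[OF ZZ(1)] by blast
      then have "Ttar z \<in> Z''" using ZZ(2) by blast
      moreover have "disjoint FF'" using wF' by (simp add: whitney_strat_def)
      ultimately have "Z'' = Z'" using Z''(1) ZZ(3,4) unfolding disjoint_def by blast
      then show ?thesis using Z'' by simp
    qed
    have Z: "submanifold Z" and Z': "submanifold Z'"
      using assms(2) wF' ZZ by (auto simp: whitney_strat_def)
    obtain T \<pi> \<rho> T' \<pi>' \<rho>' U U' where tubes: "tube Z T \<pi> \<rho>" "tube Z' T' \<pi>' \<rho>'"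
        "open U" "z \<in> U" "U \<subseteq> T" "open U'" "Ttar z \<in> U'" "U' \<subseteq> T'"
      and img: "\<And>Y Y'. Ttar ` Y = Y' \<inter> M \<Longrightarrow> Ttar ` (Y \<inter> \<pi> -` {z} \<inter> U) = Y' \<inter> \<pi>' -` {Ttar z} \<inter> U'"
      by (rule corresponding_tubes_exist[OF M Ttar TM Z ZZ(2) Z' TZ incl[OF ZZ(3)]]) (rule that)
    have "strat_iso Ttar (fiber_set F \<pi> z U) (fiber_strata FF \<pi> z U)
        (fiber_set F' \<pi>' (Ttar z) U') (fiber_strata FF' \<pi>' (Ttar z) U')"
    proof (rule strat_iso_smooth_embedding[OF Ttar])
      show "Ttar ` fiber_set F \<pi> z U = fiber_set F' \<pi>' (Ttar z) U'"
        unfolding fiber_set_def by (rule img[OF FM])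
      fix X assume "X \<in> fiber_strata FF \<pi> z U"
      then obtain Y where Y: "Y \<in> FF" "X = Y \<inter> \<pi> -` {z} \<inter> U" "X \<noteq> {}" by (auto simp: fiber_strata_def)
      obtain Y' where Y': "Y' \<in> FF'" "Ttar ` Y = Y' \<inter> M" using ex[OF Y(1)] by blast
      have "Ttar ` X = Y' \<inter> \<pi>' -` {Ttar z} \<inter> U'" unfolding Y(2) by (rule img[OF Y'(2)])
      then show "Ttar ` X \<in> fiber_strata FF' \<pi>' (Ttar z) U'"
        using Y'(1) Y(3) unfolding fiber_strata_def by blast
    qed
    with tubes show ?thesis
      by (intro exI[of _ T] exI[of _ \<pi>] exI[of _ \<rho>] exI[of _ T'] exI[of _ \<pi>'] exI[of _ \<rho>'] exI[of _ U]
          exI[of _ U'] conjI)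
  qed
  show ?thesis
    by (intro conjI ballI impI iso eq strata fibers) auto
qed

end
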